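(* Let $n\ge m\ge1$, and let $A$ be a Hermitian $n\times n$ matrix and $B$ a Hermitian $m\times m$ matrix satisfying $|A|_\infty=|B|_\infty=1$. Then: (i) for every $i=1,\dots,\lceil m/2\rceil$, $$\left|\frac{\mu_i(A)}{n}-\frac{\mu_i(B)}{m}\right|\le\frac1{\sqrt{n/2}}+\frac1{\sqrt{m/2}}+6\,\delta_\square(A,B)^{1/2}$$ and $$\left|\frac{\mu_{n-i+1}(A)}{n}-\frac{\mu_{m-i+1}(B)}{m}\right|\le\frac1{\sqrt{n/2}}+\frac1{\sqrt{m/2}}+6\,\delta_\square(A,B)^{1/2};$$ (ii.a) for every $i\in\{1,\dots,m\}$, if $\mu_i(A)\ge0$ and $\mu_i(B)\ge0$, then $$\left|\frac{\mu_i(A)}{n}-\frac{\mu_i(B)}{m}\right|\le6\,\delta_\square(A,B)^{1/2};$$ (ii.b) for every $i\in\{1,\dots,m\}$, if $\mu_{n-i+1}(A)\le0$ and $\mu_{m-i+1}(B)\le0$, then $$\left|\frac{\mu_{n-i+1}(A)}{n}-\frac{\mu_{m-i+1}(B)}{m}\right|\le6\,\delta_\square(A,B)^{1/2}.$$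
   Context: For a Hermitian matrix $M$ of size $N$, $\mu_1(M)\ge\cdots\ge\mu_N(M)$ are its eigenvalues with multiplicity. $|M|_\infty$ is the maximum modulus of the entries of $M$. For a complex $p\times q$ matrix $M$, the cut-norm is $$\|M\|_\square=\max_{X\subset[p],\,Y\subset[q]}\frac1{pq}\left|\Sigma(M[X,Y])\right|,$$ where $[p]=\{1,\dots,p\}$, $M[X,Y]$ is the submatrix with rows in $X$ and columns in $Y$, and $\Sigma$ denotes the sum of the entries. Cut-distance of Hermitian matrices: for a Hermitian matrix $M$ and an integer $p\ge1$, let $M^{(p)}=M\otimes J_p$ (Kronecker product with the $p\times p$ all-ones matrix $J_p$), i.e. each entry $a_{ij}$ is replaced by the block $a_{ij}J_p$. For Hermitian $M,N$ of the same size $d$, let $$\widehat\delta_\square(M,N)=\min\{\|M-PNP^{-1}\|_\square : P\text{ a }d\times d\text{ permutation matrix}\}.$$ For Hermitian $A$ of size $n$ and Hermitian $B$ of size $m$, define $$\delta_\square(A,B)=\lim_{k\to\infty}\widehat\delta_\square\left(A^{(km)},B^{(kn)}\right);$$ this limit exists and equals $\inf_{k\ge1}\widehat\delta_\square(A^{(km)},B^{(kn)})$. *)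

theory Defs
  imports
    "Jordan_Normal_Form.Char_Poly"
    "Jordan_Normal_Form.Schur_Decomposition"
    "Jordan_Normal_Form.DL_Submatrix"
    "HOL-Combinatorics.Permutations"
begin

text \<open>Rows and columns of a matrix are numbered from 0, as in \<^theory>\<open>Jordan_Normal_Form.Matrix\<close>;
  eigenvalues are numbered from 1.\<close>

definition hermitian_mat :: "complex mat \<Rightarrow> bool" where
  "hermitian_mat M \<longleftrightarrow> mat_adjoint M = M"

text \<open>The roots of the characteristic polynomial, with multiplicity, in decreasing order.
  They are real if the matrix is Hermitian, so that \<^const>\<open>Re\<close> only changes their type.
  The \<open>i\<close>-th eigenvalue is meaningful for \<open>1 \<le> i \<le> dim_row M\<close> only.\<close>

definition eigenvalue_list :: "complex mat \<Rightarrow> real list" where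
  "eigenvalue_list M = rev (sorted_list_of_multiset (image_mset Re (proots (char_poly M))))"

definition ith_eigenvalue :: "nat \<Rightarrow> complex mat \<Rightarrow> real" where
  "ith_eigenvalue i M = eigenvalue_list M ! (i - 1)"

definition max_entry_norm :: "complex mat \<Rightarrow> real" where
  "max_entry_norm M = Max (cmod ` elements_mat M)"

definition cut_norm :: "complex mat \<Rightarrow> real" where
  "cut_norm M = Max {1 / (real (dim_row M) * real (dim_col M)) * cmod (sum_mat (submatrix M X Y)) | X Y.
     X \<subseteq> {0..<dim_row M} \<and> Y \<subseteq> {0..<dim_col M}}"

definition kronecker_product :: "'a :: times mat \<Rightarrow> 'a mat \<Rightarrow> 'a mat" where
  "kronecker_product M N = mat (dim_row M * dim_row N) (dim_col M * dim_col N)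
     (\<lambda>(i, j). M $$ (i div dim_row N, j div dim_col N) * N $$ (i mod dim_row N, j mod dim_col N))"

definition all_ones_mat :: "nat \<Rightarrow> 'a :: one mat" where
  "all_ones_mat p = mat p p (\<lambda>_. 1)"

definition blow_up :: "nat \<Rightarrow> complex mat \<Rightarrow> complex mat" where
  "blow_up p M = kronecker_product M (all_ones_mat p)"

definition permutation_mat :: "nat \<Rightarrow> complex mat \<Rightarrow> bool" where
  "permutation_mat d P \<longleftrightarrow>
     (\<exists>\<pi>. \<pi> permutes {0..<d} \<and> P = mat d d (\<lambda>(i, j). if i = \<pi> j then 1 else 0))"

text \<open>For matrices of the same size; \<open>Q\<close> is the inverse of \<open>P\<close>.\<close>

definition aligned_cut_distance :: "complex mat \<Rightarrow> complex mat \<Rightarrow> real" where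
  "aligned_cut_distance M N = Min {cut_norm (M - P * N * Q) | P Q.
     permutation_mat (dim_row M) P \<and> Q \<in> carrier_mat (dim_row M) (dim_row M) \<and>
     inverts_mat P Q \<and> inverts_mat Q P}"

text \<open>The term for \<open>k = 0\<close>, which compares two empty matrices, does not affect the limit.\<close>

definition cut_distance :: "complex mat \<Rightarrow> complex mat \<Rightarrow> real" where
  "cut_distance A B =
     lim (\<lambda>k. aligned_cut_distance (blow_up (k * dim_row B) A) (blow_up (k * dim_row A) B))"

end

theory Submission
  imports Defs
begin

text \<open>
  Put \<open>N = k m n\<close>. The \<open>km\<close>-fold blow-up of \<open>A\<close> and the \<open>kn\<close>-fold blow-up of \<open>B\<close> both have
  size \<open>N\<close>; let \<open>D\<close> be their difference for the best alignment and \<open>d\<^sub>k\<close> its cut norm. The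
  theorem follows from a comparison of eigenvalues for each fixed \<open>k\<close>, with \<open>d\<^sub>k\<close> in place of the
  cut distance, by letting \<open>k\<close> tend to infinity.

  A small cut norm forces small eigenvalues. Let \<open>D x = \<lambda> x\<close>. The entries of \<open>D\<close> have modulus at
  most 2, so \<open>|\<lambda>| \<cdot> |x|\<^sub>\<infinity> \<le> 2 |x|\<^sub>1\<close>. Splitting complex weights into their four nonnegative parts, on
  both sides, bounds the norm of \<open>D\<close> as an operator from \<open>\<ell>\<^sub>\<infinity>\<close> to \<open>\<ell>\<^sub>1\<close> by \<open>16 N\<^sup>2 d\<^sub>k\<close>, so
  \<open>|\<lambda>| \<cdot> |x|\<^sub>1 \<le> 16 N\<^sup>2 d\<^sub>k |x|\<^sub>\<infinity>\<close>. The same vector serves in both estimates, and their product is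
  \<open>\<lambda>\<^sup>2 \<le> 32 N\<^sup>2 d\<^sub>k\<close>. Hence \<open>|\<lambda>| \<le> 6 N sqrt d\<^sub>k\<close>, and the quadratic form of \<open>D\<close> is bounded
  accordingly (\<open>eigenvalue_power2_le_cut_bound\<close>, \<open>hermitian_form_le_cut_bound\<close>).

  The comparison of ordered eigenvalues is a dimension count in the style of Weyl's inequalities
  (\<open>eigenvalue_comparison\<close>). Vectors that are constant on the blocks of \<open>A\<close> and come from the span
  of its first \<open>i\<close> eigenvectors form a space of dimension \<open>i\<close>. Orthogonality of the block sums over
  the blocks of \<open>B\<close> to the first \<open>i - 1\<close> eigenvectors of \<open>B\<close> is a system of \<open>i - 1\<close> equations, so
  some nonzero vector of that space satisfies all of them. Comparing the two quadratic forms at it gives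
  \<open>\<mu>\<^sub>i(A)/n \<le> max (\<mu>\<^sub>i(B)/m) 0 + 6 sqrt d\<^sub>k\<close>. The
  positive part appears because passing to block sums only bounds the norm from above. Exchanging
  \<open>A\<close> and \<open>B\<close>, and replacing them by their negatives, gives the four inequalities from which (ii.a)
  and (ii.b) are read off.

  For (i) it remains to bound eigenvalues of the wrong sign. If \<open>i \<le> \<lceil>m/2\<rceil>\<close> and \<open>\<mu>\<^sub>i(A) \<le> 0\<close>,
  then at least half of the eigenvalues are at least as large in modulus, while the sum of the
  squares of all of them is the sum of the squared moduli of the entries and so at most \<open>n\<^sup>2\<close>
  (\<open>negative_middle_eigenvalue_bound\<close>).

  The limit that defines the cut distance exists because an alignment for \<open>k\<close> can be repeated to
  give one for \<open>k' = q k + r\<close>, with \<open>r < k\<close>, that leaves only a fraction \<open>r / k'\<close> of the indices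
  uncontrolled: \<open>d\<^sub>k\<^sub>' \<le> d\<^sub>k + 4 r / k'\<close> (\<open>blow_up_distance_step\<close>). So the limes superior of the
  sequence is at most each of its terms.
\<close>

section \<open>Diagonalisation of Hermitian matrices\<close>

lemma mat_adjoint_carrier:
  assumes "A \<in> carrier_mat n m"
  shows "mat_adjoint A \<in> carrier_mat m n"
  using assms unfolding mat_adjoint_def by auto

lemma mat_adjoint_index:
  fixes A :: "complex mat"
  assumes "A \<in> carrier_mat n m" "i < m" "j < n"
  shows "mat_adjoint A $$ (i, j) = cnj (A $$ (j, i))"
  using assms unfolding mat_adjoint_def by (simp add: mat_of_rows_def conjugate_complex_def)

lemma mat_adjoint_mult:
  fixes A B :: "complex mat"
  assumes A: "A \<in> carrier_mat n k" and B: "B \<in> carrier_mat k m"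
  shows "mat_adjoint (A * B) = mat_adjoint B * mat_adjoint A"
proof (rule eq_matI)
  have AB: "A * B \<in> carrier_mat n m" using A B by auto
  note adj = mat_adjoint_carrier[OF A] mat_adjoint_carrier[OF B] mat_adjoint_carrier[OF AB]
  show "dim_row (mat_adjoint (A * B)) = dim_row (mat_adjoint B * mat_adjoint A)"
    "dim_col (mat_adjoint (A * B)) = dim_col (mat_adjoint B * mat_adjoint A)"
    using adj by auto
  fix i j assume "i < dim_row (mat_adjoint B * mat_adjoint A)" "j < dim_col (mat_adjoint B * mat_adjoint A)"
  then have i: "i < m" and j: "j < n" using adj by auto
  have "mat_adjoint (A * B) $$ (i, j) = cnj (\<Sum>l<k. A $$ (j, l) * B $$ (l, i))"
    using A B i j by (simp add: mat_adjoint_index[OF AB] scalar_prod_def lessThan_atLeast0)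
  also have "\<dots> = (mat_adjoint B * mat_adjoint A) $$ (i, j)"
    using A B i j adj
    by (simp add: scalar_prod_def lessThan_atLeast0 mat_adjoint_index[OF A] mat_adjoint_index[OF B] mult.commute)
  finally show "mat_adjoint (A * B) $$ (i, j) = (mat_adjoint B * mat_adjoint A) $$ (i, j)" .
qed

lemma mat_adjoint_adjoint:
  fixes A :: "complex mat"
  assumes A: "A \<in> carrier_mat n m"
  shows "mat_adjoint (mat_adjoint A) = A"
  by (rule eq_matI, insert A mat_adjoint_carrier[OF A] mat_adjoint_carrier[OF mat_adjoint_carrier[OF A]])
    (auto simp: mat_adjoint_index[OF mat_adjoint_carrier[OF A]] mat_adjoint_index[OF A])

lemma hermitian_mat_iff:
  assumes M: "M \<in> carrier_mat n n"
  shows "hermitian_mat M \<longleftrightarrow> (\<forall>i<n. \<forall>j<n. M $$ (j, i) = cnj (M $$ (i, j)))"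
proof -
  have "hermitian_mat M \<longleftrightarrow> (\<forall>i<n. \<forall>j<n. M $$ (j, i) = mat_adjoint M $$ (j, i))"
    using M mat_adjoint_carrier[OF M] unfolding hermitian_mat_def mat_eq_iff by auto
  also have "\<dots> \<longleftrightarrow> (\<forall>i<n. \<forall>j<n. M $$ (j, i) = cnj (M $$ (i, j)))"
    by (simp only: mat_adjoint_index[OF M] cong: imp_cong)
  finally show ?thesis .
qed

text \<open>Complete the vector to a basis, orthogonalise by Gram--Schmidt, and normalise the columns.\<close>

lemma exists_unitary_first_column:
  fixes v :: "complex vec"
  assumes v: "v \<in> carrier_vec n" and v0: "v \<noteq> 0\<^sub>v n"
  obtains W c where "W \<in> carrier_mat n n" "mat_adjoint W * W = 1\<^sub>m n" "col W 0 = c \<cdot>\<^sub>v v"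
proof -
  interpret cof_vec_space n "TYPE(complex)" .
  define b where "b = basis_completion v"
  define ws where "ws = gram_schmidt n b"
  from basis_completion[OF v v0, folded b_def]
  have dist_b: "distinct b" and indep: "\<not> lin_dep (set b)" and b: "set b \<subseteq> carrier_vec n"
    and hdb: "hd b = v" and len_b: "length b = n" by auto
  have n: "n \<noteq> 0" using v v0 by auto
  from hdb len_b n obtain vs where bv: "b = v # vs" by (cases b, auto)
  from gram_schmidt_result[OF b dist_b indep refl, folded ws_def]
  have ws: "set ws \<subseteq> carrier_vec n" "corthogonal ws" "length ws = n"
    by (auto simp: len_b)
  from gram_schmidt_hd[OF v, of vs, folded bv] have hdws: "hd ws = v" unfolding ws_def .
  define c where "c i = 1 / complex_of_real (sqrt (Re (ws ! i \<bullet>c ws ! i)))" for i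
  define W where "W = mat n n (\<lambda>(k, i). c i * ws ! i $ k)"
  have W: "W \<in> carrier_mat n n" by (simp add: W_def)
  have wsi: "ws ! i \<in> carrier_vec n" if "i < n" for i using ws that by auto
  have norm_pos: "ws ! i \<bullet>c ws ! i > 0" if "i < n" for i
    using corthogonalD[OF ws(2), of i i] conjugate_square_ge_0_vec[of "ws ! i"] that ws(3)
    by (simp add: order.strict_iff_order)
  have "mat_adjoint W * W = 1\<^sub>m n"
  proof (rule eq_matI)
    fix i j assume "i < dim_row (1\<^sub>m n :: complex mat)" "j < dim_col (1\<^sub>m n :: complex mat)"
    then have i: "i < n" and j: "j < n" by auto
    have "(mat_adjoint W * W) $$ (i, j) = (\<Sum>k<n. cnj (c i * ws ! i $ k) * (c j * ws ! j $ k))"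
      using W mat_adjoint_carrier[OF W] i j
      by (simp add: scalar_prod_def lessThan_atLeast0 mat_adjoint_index[OF W]) (simp add: W_def)
    also have "\<dots> = cnj (c i) * c j * (ws ! j \<bullet>c ws ! i)"
      using wsi[OF i] wsi[OF j]
      by (simp add: scalar_prod_def lessThan_atLeast0 sum_distrib_left conjugate_complex_def algebra_simps)
    also have "\<dots> = (if i = j then 1 else 0)"
    proof (cases "i = j")
      case True
      define r where "r = Re (ws ! i \<bullet>c ws ! i)"
      have r: "ws ! i \<bullet>c ws ! i = of_real r" "r > 0"
        using norm_pos[OF i] by (auto simp: r_def less_complex_def complex_eq_iff)
      have "complex_of_real (sqrt r) * complex_of_real (sqrt r) = of_real r"
        using r(2) by (simp flip: of_real_mult)
      then show ?thesis using r True unfolding c_def r_def[symmetric]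
        by (simp add: field_simps)
    next
      case False
      then show ?thesis using corthogonalD[OF ws(2), of j i] i j ws(3) by auto
    qed
    finally show "(mat_adjoint W * W) $$ (i, j) = (1\<^sub>m n) $$ (i, j)" using i j by simp
  qed (use W mat_adjoint_carrier[OF W] in auto)
  moreover have "col W 0 = c 0 \<cdot>\<^sub>v v"
  proof -
    have "ws ! 0 = v" using hdws ws(3) n by (cases ws) auto
    then show ?thesis using n v by (intro eq_vecI) (auto simp: W_def)
  qed
  ultimately show ?thesis using that W by blast
qed

text \<open>Induction on the list of eigenvalues, which may be given in any order. Conjugating by a unitary
matrix whose first column is an eigenvector for the first eigenvalue clears the rest of the first
column and, by symmetry, the rest of the first row. The remaining block is Hermitian again, and its
characteristic polynomial has lost exactly the factor that belongs to that eigenvalue.\<close>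

lemma hermitian_unitarily_diagonalizable:
  fixes A :: "complex mat"
  assumes "A \<in> carrier_mat n n" "mat_adjoint A = A" "char_poly A = (\<Prod>e\<leftarrow>es. [:- e, 1:])"
  shows "\<exists>U \<in> carrier_mat n n. mat_adjoint U * U = 1\<^sub>m n \<and>
    mat_adjoint U * A * U = mat n n (\<lambda>(i, j). if i = j then es ! i else 0)"
  using assms
proof (induction es arbitrary: n A)
  case Nil
  with degree_monic_char_poly[of A n] have "n = 0" by auto
  then show ?case using Nil.prems mat_adjoint_carrier[of "1\<^sub>m 0 :: complex mat" 0 0]
    by (intro bexI[of _ "1\<^sub>m 0"]) auto
next
  case (Cons e es)
  let ?m = "n - 1"
  note A = Cons.prems(1)
  have cp: "char_poly A = [:- e, 1:] * (\<Prod>e\<leftarrow>es. [:- e, 1:])" using Cons.prems(3) by simp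
  have mon: "monic (\<Prod>e\<leftarrow>es. [:- e, 1:])" by (rule monic_prod_list) auto
  have "degree (char_poly A) = Suc (degree (\<Prod>e\<leftarrow>es. [:- e, 1:]))"
    unfolding cp by (subst degree_mult_eq, insert mon, auto)
  with degree_monic_char_poly[OF A] have n: "n \<noteq> 0" by auto
  have "eigenvalue A e" unfolding eigenvalue_root_char_poly[OF A] cp by simp
  then obtain v where v: "v \<in> carrier_vec n" "v \<noteq> 0\<^sub>v n" and ev: "A *\<^sub>v v = e \<cdot>\<^sub>v v"
    using A unfolding eigenvalue_def eigenvector_def by auto
  obtain W c where W: "W \<in> carrier_mat n n" and WW: "mat_adjoint W * W = 1\<^sub>m n"
    and W0: "col W 0 = c \<cdot>\<^sub>v v"
    by (rule exists_unitary_first_column[OF v])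
  let ?W' = "mat_adjoint W"
  have W': "?W' \<in> carrier_mat n n" by (rule mat_adjoint_carrier[OF W])
  have WW': "W * ?W' = 1\<^sub>m n" by (rule mat_mult_left_right_inverse[OF W' W WW])
  define A' where "A' = ?W' * A * W"
  have A': "A' \<in> carrier_mat n n" unfolding A'_def using W W' A by auto
  have herm': "mat_adjoint A' = A'"
  proof -
    have "mat_adjoint A' = mat_adjoint W * mat_adjoint (?W' * A)"
      unfolding A'_def by (rule mat_adjoint_mult[of _ n n _ n]) (use W W' A in auto)
    also have "mat_adjoint (?W' * A) = A * W"
      using mat_adjoint_mult[OF W' A] mat_adjoint_adjoint[OF W] Cons.prems(2) by simp
    finally show ?thesis unfolding A'_def using W W' A by (simp add: assoc_mult_mat[of _ n n _ n _ n])
  qed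
  have col0: "A' $$ (i, 0) = (if i = 0 then e else 0)" if i: "i < n" for i
  proof -
    have "col (A * W) 0 = A *\<^sub>v col W 0" using A W n by auto
    also have "\<dots> = e \<cdot>\<^sub>v col W 0"
      unfolding W0 using A v ev by (simp add: mult_mat_vec smult_smult_assoc mult.commute)
    finally have *: "col (A * W) 0 = e \<cdot>\<^sub>v col W 0" .
    have "A' $$ (i, 0) = row ?W' i \<bullet> col (A * W) 0"
      unfolding A'_def using W W' A i n by (subst assoc_mult_mat[of _ n n _ n _ n]) auto
    also have "\<dots> = e * (row ?W' i \<bullet> col W 0)" unfolding * using W W' i by simp
    also have "row ?W' i \<bullet> col W 0 = (?W' * W) $$ (i, 0)" using W W' i n by simp
    finally show ?thesis unfolding WW using i n by simp
  qed
  define A3 where "A3 = mat ?m ?m (\<lambda>(i, j). A' $$ (Suc i, Suc j))"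
  have A3: "A3 \<in> carrier_mat ?m ?m" by (simp add: A3_def)
  have row0: "A' $$ (0, j) = (if j = 0 then e else 0)" if j: "j < n" for j
  proof (cases "j = 0")
    case False
    have "A' $$ (0, j) = cnj (A' $$ (j, 0))"
      using mat_adjoint_index[OF A', of 0 j] herm' j n by simp
    then show ?thesis using col0[OF j] False by simp
  qed (use col0[of 0] n in simp)
  let ?E = "mat 1 1 (\<lambda>_. e)"
  have block: "A' = four_block_mat ?E (0\<^sub>m 1 ?m) (0\<^sub>m ?m 1) A3"
    by (rule eq_matI) (use A' n col0 row0 in \<open>auto simp: A3_def\<close>)
  have "similar_mat A' A"
    unfolding similar_mat_def
    by (intro exI[of _ ?W'] exI[of _ W] similar_mat_witI[of _ _ n])
      (use W W' A A' WW WW' in \<open>auto simp: A'_def\<close>)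
  then have "char_poly A' = [:- e, 1:] * (\<Prod>e\<leftarrow>es. [:- e, 1:])"
    using char_poly_similar[of A' A] cp by metis
  moreover have "char_poly A' = char_poly ?E * char_poly A3"
    unfolding block by (rule char_poly_four_block_zeros_col[of _ _ ?m]) (use A3 in auto)
  moreover have "char_poly ?E = [:- e, 1:]"
    by (simp add: char_poly_defs det_def sign_def)
  ultimately have cp3: "char_poly A3 = (\<Prod>e\<leftarrow>es. [:- e, 1:])"
    by (metis mult_cancel_left pCons_eq_0_iff zero_neq_one)
  have "mat_adjoint A3 = A3"
  proof (rule eq_matI)
    fix i j assume "i < dim_row A3" "j < dim_col A3"
    then have ij: "i < ?m" "j < ?m" using A3 by auto
    then have "mat_adjoint A3 $$ (i, j) = cnj (A' $$ (Suc j, Suc i))"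
      by (subst mat_adjoint_index[OF A3]) (auto simp: A3_def)
    also have "\<dots> = A' $$ (Suc i, Suc j)"
      using mat_adjoint_index[OF A', of "Suc i" "Suc j"] herm' ij by simp
    finally show "mat_adjoint A3 $$ (i, j) = A3 $$ (i, j)" using ij by (simp add: A3_def)
  qed (use mat_adjoint_carrier[OF A3] A3 in auto)
  from Cons.IH[OF A3 this cp3] obtain U3 where U3: "U3 \<in> carrier_mat ?m ?m"
    and UU3: "mat_adjoint U3 * U3 = 1\<^sub>m ?m"
    and diag3: "mat_adjoint U3 * A3 * U3 = mat ?m ?m (\<lambda>(i, j). if i = j then es ! i else 0)"
    by blast
  have U3': "mat_adjoint U3 \<in> carrier_mat ?m ?m" by (rule mat_adjoint_carrier[OF U3])
  define V where "V = four_block_mat (1\<^sub>m 1) (0\<^sub>m 1 ?m) (0\<^sub>m ?m 1) U3"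
  have V: "V \<in> carrier_mat n n" using U3 n by (auto simp: V_def)
  have V': "mat_adjoint V \<in> carrier_mat n n" by (rule mat_adjoint_carrier[OF V])
  have Vadj: "mat_adjoint V = four_block_mat (1\<^sub>m 1) (0\<^sub>m 1 ?m) (0\<^sub>m ?m 1) (mat_adjoint U3)"
  proof (rule eq_matI)
    have Vij: "V $$ (i, j) = (if i = 0 \<or> j = 0 then of_bool (i = j) else U3 $$ (i - 1, j - 1))"
      if "i < n" "j < n" for i j
      using that U3 n by (auto simp: V_def)
    fix i j
    assume "i < dim_row (four_block_mat (1\<^sub>m 1 :: complex mat) (0\<^sub>m 1 ?m) (0\<^sub>m ?m 1) (mat_adjoint U3))"
      "j < dim_col (four_block_mat (1\<^sub>m 1 :: complex mat) (0\<^sub>m 1 ?m) (0\<^sub>m ?m 1) (mat_adjoint U3))"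
    then have ij: "i < n" "j < n" using U3' n by auto
    show "mat_adjoint V $$ (i, j) =
        four_block_mat (1\<^sub>m 1) (0\<^sub>m 1 ?m) (0\<^sub>m ?m 1) (mat_adjoint U3) $$ (i, j)"
      using ij U3' U3 n
      by (auto simp: mat_adjoint_index[OF V] mat_adjoint_index[OF U3] Vij)
  qed (use V' U3' n in auto)
  have VV: "mat_adjoint V * V = 1\<^sub>m n"
    unfolding Vadj unfolding V_def
    by (subst mult_four_block_mat[of _ 1 1 _ ?m _ ?m _ _ 1 _ ?m])
      (use U3 U3' UU3 n in \<open>auto simp: four_block_one_mat[symmetric]\<close>)
  have VAV: "mat_adjoint V * A' * V =
      four_block_mat ?E (0\<^sub>m 1 ?m) (0\<^sub>m ?m 1) (mat_adjoint U3 * A3 * U3)"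
    unfolding Vadj block unfolding V_def
    by (subst mult_four_block_mat[of _ 1 1 _ ?m _ ?m _ _ 1 _ ?m], use U3 U3' A3 in auto,
        subst mult_four_block_mat[of _ 1 1 _ ?m _ ?m _ _ 1 _ ?m], use U3 U3' A3 in auto)
  have U: "W * V \<in> carrier_mat n n" using W V by auto
  have adjU: "mat_adjoint (W * V) = mat_adjoint V * ?W'" by (rule mat_adjoint_mult[OF W V])
  have "mat_adjoint (W * V) * (W * V) = mat_adjoint V * (?W' * W) * V"
    unfolding adjU using W V W' V' by (simp add: assoc_mult_mat[of _ n n _ n _ n])
  then have "mat_adjoint (W * V) * (W * V) = 1\<^sub>m n" using WW VV V V' by simp
  moreover have "mat_adjoint (W * V) * A * (W * V) = mat_adjoint V * A' * V"
    unfolding adjU A'_def using W V W' V' A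
    by (simp add: assoc_mult_mat[of _ n n _ n _ n] mult_carrier_mat[of _ n n _ n])
  moreover have "mat_adjoint V * A' * V = mat n n (\<lambda>(i, j). if i = j then (e # es) ! i else 0)"
    unfolding VAV diag3 by (rule eq_matI) (use n in \<open>auto simp: nth_Cons'\<close>)
  ultimately show ?case using U by (intro bexI[of _ "W * V"]) auto
qed

section \<open>Orthonormal eigenbases and quadratic forms\<close>

text \<open>From here on matrices and vectors are functions, with the eigenvectors indexed first: \<open>u j\<close> is the
\<open>j\<close>-th eigenvector. The second condition is completeness; it makes the expansion of vectors
available without a dimension argument.\<close>

definition orthonormal_eigenbasis ::
    "nat \<Rightarrow> (nat \<Rightarrow> nat \<Rightarrow> complex) \<Rightarrow> (nat \<Rightarrow> nat \<Rightarrow> complex) \<Rightarrow> (nat \<Rightarrow> real) \<Rightarrow> bool" where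
  "orthonormal_eigenbasis n f u \<mu> \<longleftrightarrow>
     (\<forall>i<n. \<forall>j<n. (\<Sum>k<n. cnj (u i k) * u j k) = of_bool (i = j)) \<and>
     (\<forall>k<n. \<forall>l<n. (\<Sum>j<n. u j k * cnj (u j l)) = of_bool (k = l)) \<and>
     (\<forall>j<n. \<forall>k<n. (\<Sum>l<n. f k l * u j l) = of_real (\<mu> j) * u j k)"

lemma proots_prod_linear_factors:
  "proots (\<Prod>a\<leftarrow>as. [:- a, 1:]) = mset (as :: complex list)"
proof (induction as)
  case (Cons a as)
  have "(\<Prod>a\<leftarrow>as. [:- a, 1:]) \<noteq> 0" by (auto simp: prod_list_zero_iff)
  then have "proots ([:- a, 1:] * (\<Prod>a\<leftarrow>as. [:- a, 1:])) = {#a#} + mset as"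
    using Cons by (subst proots_mult) auto
  then show ?case by simp
qed simp

text \<open>Diagonalising once shows that the roots of the characteristic polynomial are real. Taking real parts
therefore loses nothing, and diagonalising a second time with the roots in decreasing order yields
eigenvectors numbered like \<^const>\<open>eigenvalue_list\<close>.\<close>

lemma hermitian_eigenbasis:
  assumes M: "M \<in> carrier_mat n n" and herm: "hermitian_mat M"
  shows "length (eigenvalue_list M) = n"
    and "\<And>j l. j \<le> l \<Longrightarrow> l < n \<Longrightarrow> eigenvalue_list M ! l \<le> eigenvalue_list M ! j"
    and "\<exists>u. orthonormal_eigenbasis n (\<lambda>k l. M $$ (k, l)) u (\<lambda>j. eigenvalue_list M ! j)"
proof -
  have adj: "mat_adjoint M = M" using herm by (simp add: hermitian_mat_def)
  obtain as where as: "char_poly M = (\<Prod>a\<leftarrow>as. [:- a, 1:])" and len: "length as = n"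
    using char_poly_factorized[OF M] by auto
  obtain U where U: "U \<in> carrier_mat n n"
    and diag: "mat_adjoint U * M * U = mat n n (\<lambda>(i, j). if i = j then as ! i else 0)"
    using hermitian_unitarily_diagonalizable[OF M adj as] by auto
  have U': "mat_adjoint U \<in> carrier_mat n n" by (rule mat_adjoint_carrier[OF U])
  have "mat_adjoint (mat_adjoint U * M * U) = mat_adjoint U * M * U"
    using mat_adjoint_mult[of "mat_adjoint U * M" n n U n] mat_adjoint_mult[OF U' M]
      mat_adjoint_adjoint[OF U] adj U U' M by (simp add: assoc_mult_mat[of _ n n _ n _ n])
  then have real: "cnj (as ! i) = as ! i" if "i < n" for i
    using mat_adjoint_index[of "mat_adjoint U * M * U" n n i i] that
    unfolding diag by auto
  have list: "eigenvalue_list M = rev (sort (map Re as))"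
    unfolding eigenvalue_list_def as proots_prod_linear_factors
    by (metis mset_map sorted_list_of_multiset_mset)
  show len': "length (eigenvalue_list M) = n" using len by (simp add: list)
  have sorted: "sorted (rev (eigenvalue_list M))" by (simp add: list)
  show "eigenvalue_list M ! l \<le> eigenvalue_list M ! j" if "j \<le> l" "l < n" for j l
    using sorted_rev_nth_mono[OF sorted] that len' by simp
  define es where "es = map complex_of_real (eigenvalue_list M)"
  have "map complex_of_real (map Re as) = as"
    using real len by (intro nth_equalityI) (auto simp: complex_eq_iff)
  then have "mset es = mset as"
    unfolding es_def list by (metis mset_map mset_rev mset_sort)
  then have "char_poly M = (\<Prod>a\<leftarrow>es. [:- a, 1:])"
    unfolding as by (metis mset_map prod_mset_prod_list)
  from hermitian_unitarily_diagonalizable[OF M adj this] obtain V where V: "V \<in> carrier_mat n n"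
    and VV: "mat_adjoint V * V = 1\<^sub>m n"
    and diag: "mat_adjoint V * M * V = mat n n (\<lambda>(i, j). if i = j then es ! i else 0)"
    by auto
  have V': "mat_adjoint V \<in> carrier_mat n n" by (rule mat_adjoint_carrier[OF V])
  have VV': "V * mat_adjoint V = 1\<^sub>m n" by (rule mat_mult_left_right_inverse[OF V' V VV])
  have "M * V = V * mat_adjoint V * (M * V)" using M V VV' by simp
  also have "\<dots> = V * (mat_adjoint V * M * V)"
    using M V V' by (simp add: assoc_mult_mat[of _ n n _ n _ n])
  finally have MV: "M * V = V * mat n n (\<lambda>(i, j). if i = j then es ! i else 0)" unfolding diag .
  have "(\<Sum>k<n. cnj (V $$ (k, i)) * V $$ (k, j)) = of_bool (i = j)" if "i < n" "j < n" for i j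
  proof -
    have "(\<Sum>k<n. cnj (V $$ (k, i)) * V $$ (k, j)) = (mat_adjoint V * V) $$ (i, j)"
      using V V' that by (simp add: scalar_prod_def lessThan_atLeast0 mat_adjoint_index[OF V])
    then show ?thesis unfolding VV using that by simp
  qed
  moreover have "(\<Sum>j<n. V $$ (k, j) * cnj (V $$ (l, j))) = of_bool (k = l)" if "k < n" "l < n" for k l
  proof -
    have "(\<Sum>j<n. V $$ (k, j) * cnj (V $$ (l, j))) = (V * mat_adjoint V) $$ (k, l)"
      using V V' that by (simp add: scalar_prod_def lessThan_atLeast0 mat_adjoint_index[OF V])
    then show ?thesis unfolding VV' using that by simp
  qed
  moreover have "(\<Sum>l<n. M $$ (k, l) * V $$ (l, j)) = of_real (eigenvalue_list M ! j) * V $$ (k, j)"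
    if "j < n" "k < n" for j k
  proof -
    have "(\<Sum>l<n. M $$ (k, l) * V $$ (l, j)) = (M * V) $$ (k, j)"
      using M V that by (simp add: scalar_prod_def lessThan_atLeast0)
    also have "\<dots> = (\<Sum>l<n. V $$ (k, l) * (if l = j then es ! l else 0))"
      unfolding MV using V that by (simp add: scalar_prod_def lessThan_atLeast0)
    also have "\<dots> = V $$ (k, j) * es ! j"
      using that by (simp add: if_distrib[of "(*) _"] cong: if_cong)
    finally show ?thesis using that len' by (simp add: es_def)
  qed
  ultimately show "\<exists>u. orthonormal_eigenbasis n (\<lambda>k l. M $$ (k, l)) u (\<lambda>j. eigenvalue_list M ! j)"
    unfolding orthonormal_eigenbasis_def by (intro exI[of _ "\<lambda>j k. V $$ (k, j)"]) auto
qed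

lemma orthonormal_expansion:
  assumes "orthonormal_eigenbasis n f u \<mu>" "k < n"
  shows "z k = (\<Sum>j<n. (\<Sum>l<n. cnj (u j l) * z l) * u j k)"
proof -
  have "(\<Sum>j<n. (\<Sum>l<n. cnj (u j l) * z l) * u j k) = (\<Sum>j<n. \<Sum>l<n. z l * (u j k * cnj (u j l)))"
    by (simp add: sum_distrib_left sum_distrib_right algebra_simps)
  also have "\<dots> = (\<Sum>l<n. z l * (\<Sum>j<n. u j k * cnj (u j l)))"
    by (subst sum.swap) (simp add: sum_distrib_left)
  also have "\<dots> = (\<Sum>l<n. z l * of_bool (k = l))"
    using assms by (intro sum.cong) (auto simp: orthonormal_eigenbasis_def)
  finally show ?thesis using assms(2) by simp
qed

lemma orthonormal_pairing:
  fixes d :: "nat \<Rightarrow> complex"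
  shows "(\<Sum>k<n. cnj (z k) * (\<Sum>j<n. d j * u j k))
    = (\<Sum>j<n. d j * cnj (\<Sum>l<n. cnj (u j l) * z l))"
proof -
  have "(\<Sum>k<n. cnj (z k) * (\<Sum>j<n. d j * u j k)) = (\<Sum>k<n. \<Sum>j<n. d j * (u j k * cnj (z k)))"
    by (simp add: sum_distrib_left algebra_simps)
  also have "\<dots> = (\<Sum>j<n. d j * (\<Sum>l<n. u j l * cnj (z l)))"
    by (subst sum.swap) (simp add: sum_distrib_left)
  finally show ?thesis by simp
qed

lemma orthonormal_parseval:
  assumes "orthonormal_eigenbasis n f u \<mu>"
  shows "(\<Sum>k<n. (cmod (z k))\<^sup>2) = (\<Sum>j<n. (cmod (\<Sum>l<n. cnj (u j l) * z l))\<^sup>2)"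
proof -
  define c where "c j = (\<Sum>l<n. cnj (u j l) * z l)" for j
  have expand: "z k = (\<Sum>j<n. c j * u j k)" if "k < n" for k
    unfolding c_def by (rule orthonormal_expansion[OF assms that])
  have "complex_of_real (\<Sum>k<n. (cmod (z k))\<^sup>2) = (\<Sum>k<n. cnj (z k) * z k)"
    by (simp only: of_real_sum complex_norm_square mult.commute)
  also have "\<dots> = (\<Sum>k<n. cnj (z k) * (\<Sum>j<n. c j * u j k))"
    by (intro sum.cong) (simp_all add: expand[symmetric])
  also have "\<dots> = (\<Sum>j<n. c j * cnj (c j))" unfolding orthonormal_pairing c_def ..
  also have "\<dots> = of_real (\<Sum>j<n. (cmod (c j))\<^sup>2)"
    by (simp only: of_real_sum complex_norm_square)
  finally show ?thesis unfolding of_real_eq_iff c_def .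
qed

lemma quadratic_form_diagonal:
  assumes E: "orthonormal_eigenbasis n f u \<mu>"
  shows "(\<Sum>k<n. \<Sum>l<n. cnj (z k) * f k l * z l)
    = of_real (\<Sum>j<n. \<mu> j * (cmod (\<Sum>l<n. cnj (u j l) * z l))\<^sup>2)"
proof -
  define c where "c j = (\<Sum>l<n. cnj (u j l) * z l)" for j
  have expand: "z k = (\<Sum>j<n. c j * u j k)" if "k < n" for k
    unfolding c_def by (rule orthonormal_expansion[OF E that])
  have "(\<Sum>l<n. f k l * z l) = (\<Sum>j<n. (\<mu> j * c j) * u j k)" if "k < n" for k
  proof -
    have "(\<Sum>l<n. f k l * z l) = (\<Sum>l<n. f k l * (\<Sum>j<n. c j * u j l))"
      by (intro sum.cong) (simp_all add: expand[symmetric])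
    also have "\<dots> = (\<Sum>l<n. \<Sum>j<n. c j * (f k l * u j l))"
      by (simp add: sum_distrib_left algebra_simps)
    also have "\<dots> = (\<Sum>j<n. c j * (\<Sum>l<n. f k l * u j l))"
      by (subst sum.swap) (simp add: sum_distrib_left)
    also have "\<dots> = (\<Sum>j<n. (\<mu> j * c j) * u j k)"
      using E that by (intro sum.cong) (auto simp: orthonormal_eigenbasis_def)
    finally show ?thesis .
  qed
  then have "(\<Sum>k<n. \<Sum>l<n. cnj (z k) * f k l * z l) = (\<Sum>k<n. cnj (z k) * (\<Sum>j<n. (\<mu> j * c j) * u j k))"
    by (simp add: sum_distrib_left[symmetric] mult.assoc)
  also have "\<dots> = (\<Sum>j<n. \<mu> j * c j * cnj (c j))" unfolding orthonormal_pairing c_def ..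
  also have "\<dots> = of_real (\<Sum>j<n. \<mu> j * (cmod (c j))\<^sup>2)"
    by (simp only: of_real_sum of_real_mult complex_norm_square mult.assoc)
  finally show ?thesis unfolding c_def .
qed

text \<open>Reversing the order of the eigenvectors keeps the eigenvalues of the negated matrix decreasing. This
reduces every statement about the smallest eigenvalues to one about the largest.\<close>

lemma orthonormal_eigenbasis_uminus:
  assumes E: "orthonormal_eigenbasis n f u \<mu>"
  shows "orthonormal_eigenbasis n (\<lambda>k l. - f k l) (\<lambda>j. u (n - 1 - j)) (\<lambda>j. - \<mu> (n - 1 - j))"
proof -
  have "(\<Sum>j<n. u (n - 1 - j) k * cnj (u (n - 1 - j) l)) = (\<Sum>j<n. u j k * cnj (u j l))" for k l
    using sum.nat_diff_reindex[of "\<lambda>j. u j k * cnj (u j l)" n] by simp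
  moreover have "(n - 1 - i = n - 1 - j) = (i = j)" if "i < n" "j < n" for i j using that by auto
  ultimately show ?thesis
    using E unfolding orthonormal_eigenbasis_def by (auto simp: sum_negf)
qed

text \<open>Both sides are the squared Frobenius norm: apply Parseval's identity to each conjugated row, whose
coefficients are the conjugated entries of \<open>f\<close> applied to the eigenvectors.\<close>

lemma sum_eigenvalue_squares:
  assumes E: "orthonormal_eigenbasis n f u \<mu>"
  shows "(\<Sum>j<n. (\<mu> j)\<^sup>2) = (\<Sum>k<n. \<Sum>l<n. (cmod (f k l))\<^sup>2)"
proof -
  have u1: "(\<Sum>k<n. (cmod (u j k))\<^sup>2) = 1" if "j < n" for j
  proof -
    have "complex_of_real (\<Sum>k<n. (cmod (u j k))\<^sup>2) = (\<Sum>k<n. cnj (u j k) * u j k)"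
      by (simp only: of_real_sum complex_norm_square mult.commute)
    also have "\<dots> = 1" using E that by (auto simp: orthonormal_eigenbasis_def)
    finally show ?thesis using of_real_eq_1_iff by blast
  qed
  have "(\<Sum>k<n. \<Sum>l<n. (cmod (f k l))\<^sup>2) = (\<Sum>k<n. \<Sum>j<n. (cmod (of_real (\<mu> j) * u j k))\<^sup>2)"
  proof (rule sum.cong[OF refl])
    fix k assume k: "k \<in> {..<n}"
    have "(\<Sum>l<n. (cmod (f k l))\<^sup>2) = (\<Sum>l<n. (cmod (cnj (f k l)))\<^sup>2)" by simp
    also have "\<dots> = (\<Sum>j<n. (cmod (\<Sum>l<n. cnj (u j l) * cnj (f k l)))\<^sup>2)"
      by (rule orthonormal_parseval[OF E])
    also have "\<dots> = (\<Sum>j<n. (cmod (\<Sum>l<n. f k l * u j l))\<^sup>2)"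
      by (subst complex_mod_cnj[symmetric]) (simp add: mult.commute)
    also have "\<dots> = (\<Sum>j<n. (cmod (of_real (\<mu> j) * u j k))\<^sup>2)"
      using E k by (intro sum.cong) (auto simp: orthonormal_eigenbasis_def)
    finally show "(\<Sum>l<n. (cmod (f k l))\<^sup>2) = (\<Sum>j<n. (cmod (of_real (\<mu> j) * u j k))\<^sup>2)" .
  qed
  also have "\<dots> = (\<Sum>j<n. (\<mu> j)\<^sup>2 * (\<Sum>k<n. (cmod (u j k))\<^sup>2))"
    by (subst sum.swap) (simp add: norm_mult power_mult_distrib sum_distrib_left)
  also have "\<dots> = (\<Sum>j<n. (\<mu> j)\<^sup>2)" by (intro sum.cong) (auto simp: u1)
  finally show ?thesis by simp
qed

text \<open>The eigenvalues from index \<open>i\<close> on are at least half of all, and none of them is smaller in modulus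
than \<open>\<mu> i\<close>. So \<open>n/2 \<cdot> (\<mu> i)\<^sup>2\<close> is at most the sum of all squared eigenvalues, which is at most
\<open>n\<^sup>2\<close>.\<close>

lemma negative_middle_eigenvalue_bound:
  assumes E: "orthonormal_eigenbasis n f u \<mu>" and \<mu>: "\<And>j l. j \<le> l \<Longrightarrow> l < n \<Longrightarrow> \<mu> l \<le> \<mu> j"
    and f: "\<And>k l. k < n \<Longrightarrow> l < n \<Longrightarrow> cmod (f k l) \<le> 1"
    and i: "2 * i < n + 1" "i < n" and neg: "\<mu> i \<le> 0"
  shows "- \<mu> i / n \<le> 1 / sqrt (real n / 2)"
proof -
  have "real (n - i) * (\<mu> i)\<^sup>2 = (\<Sum>j\<in>{i..<n}. (\<mu> i)\<^sup>2)" by simp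
  also have "\<dots> \<le> (\<Sum>j\<in>{i..<n}. (\<mu> j)\<^sup>2)"
  proof (intro sum_mono)
    fix j assume "j \<in> {i..<n}"
    then have "\<bar>\<mu> i\<bar> \<le> \<bar>\<mu> j\<bar>" using \<mu>[of i j] neg by auto
    then show "(\<mu> i)\<^sup>2 \<le> (\<mu> j)\<^sup>2" by (simp add: abs_le_square_iff)
  qed
  also have "\<dots> \<le> (\<Sum>j<n. (\<mu> j)\<^sup>2)" by (intro sum_mono2) auto
  also have "\<dots> \<le> (\<Sum>k<n. \<Sum>l<n. 1)"
    unfolding sum_eigenvalue_squares[OF E] using f by (intro sum_mono) (auto simp: power_le_one)
  finally have "real (n - i) * (\<mu> i)\<^sup>2 \<le> (real n)\<^sup>2" by (simp add: power2_eq_square)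
  moreover have "real n / 2 \<le> real (n - i)" using i by (simp add: of_nat_diff)
  ultimately have "real n / 2 * (\<mu> i)\<^sup>2 \<le> (real n)\<^sup>2"
    by (meson mult_right_mono order_trans zero_le_power2)
  then have "sqrt (real n / 2 * (\<mu> i)\<^sup>2) \<le> real n" by (simp add: real_le_lsqrt)
  then have "sqrt (real n / 2) * (- \<mu> i) \<le> real n" using neg unfolding real_sqrt_mult by simp
  then show ?thesis using i by (simp add: field_simps)
qed

section \<open>Balanced labellings\<close>

text \<open>Such a labelling turns \<open>S\<close> into the index set of the \<open>p\<close>-fold blow-up of an \<open>n \<times> n\<close> matrix, in
which the entry at \<open>(x, y)\<close> is the original entry at \<open>(\<alpha> x, \<alpha> y)\<close>. Since neither an order of \<open>S\<close> nor
the position of the blocks is prescribed, an alignment of two blow-ups is just a pair of balanced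
labellings of the same set.\<close>

definition balanced_labelling :: "'a set \<Rightarrow> ('a \<Rightarrow> nat) \<Rightarrow> nat \<Rightarrow> nat \<Rightarrow> bool" where
  "balanced_labelling S \<alpha> n p \<longleftrightarrow>
     finite S \<and> (\<forall>x\<in>S. \<alpha> x < n) \<and> (\<forall>a<n. card {x\<in>S. \<alpha> x = a} = p)"

lemma sum_over_labels:
  assumes "balanced_labelling S \<alpha> n p"
  shows "(\<Sum>x\<in>S. F x) = (\<Sum>a<n. \<Sum>x\<in>{x\<in>S. \<alpha> x = a}. F x)"
  using assms unfolding balanced_labelling_def
  by (intro sum.group[symmetric]) auto

lemma sum_of_label_function:
  assumes "balanced_labelling S \<alpha> n p"
  shows "(\<Sum>x\<in>S. F (\<alpha> x)) = of_nat p * (\<Sum>a<n. F a :: 'b :: semiring_1)"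
proof -
  have "(\<Sum>x\<in>S. F (\<alpha> x)) = (\<Sum>a<n. \<Sum>x\<in>{x\<in>S. \<alpha> x = a}. F a)"
    unfolding sum_over_labels[OF assms] by (intro sum.cong) auto
  also have "\<dots> = (\<Sum>a<n. of_nat p * F a)"
    using assms by (intro sum.cong) (auto simp: balanced_labelling_def)
  finally show ?thesis by (simp add: sum_distrib_left)
qed

lemma balanced_labelling_card:
  assumes "balanced_labelling S \<alpha> n p"
  shows "card S = n * p"
  using sum_of_label_function[OF assms, of "\<lambda>_. 1 :: nat"] by simp

lemma balanced_labelling_div: "balanced_labelling {..<n * p} (\<lambda>x. x div p) n p"
proof (cases "p = 0")
  case False
  have "{x \<in> {..<n * p}. x div p = a} = {a * p..<a * p + p}" if "a < n" for a
  proof -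
    have "x < n * p" if "x div p = a" for x
      using that \<open>a < n\<close> False by (metis div_less_iff_less_mult not_gr_zero)
    then show ?thesis
      using False by (auto simp: div_nat_eqI dividend_less_times_div less_eq_div_iff_mult_less_eq algebra_simps)
  qed
  then show ?thesis unfolding balanced_labelling_def
    using False by (auto simp: div_less_iff_less_mult)
qed (auto simp: balanced_labelling_def)

lemma balanced_labelling_permute:
  assumes "balanced_labelling S \<alpha> n p" "\<pi> permutes S"
  shows "balanced_labelling S (\<lambda>x. \<alpha> (\<pi> x)) n p"
proof -
  have "card {x\<in>S. \<alpha> (\<pi> x) = a} = card {x\<in>S. \<alpha> x = a}" for a
  proof (rule bij_betw_same_card)
    show "bij_betw \<pi> {x\<in>S. \<alpha> (\<pi> x) = a} {x\<in>S. \<alpha> x = a}"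
      unfolding bij_betw_def
    proof
      show "inj_on \<pi> {x\<in>S. \<alpha> (\<pi> x) = a}" using permutes_inj[OF assms(2)] inj_on_subset by blast
      show "\<pi> ` {x\<in>S. \<alpha> (\<pi> x) = a} = {x\<in>S. \<alpha> x = a}"
        using permutes_image[OF assms(2)] by fastforce
    qed
  qed
  then show ?thesis using assms permutes_in_image[OF assms(2)]
    by (auto simp: balanced_labelling_def)
qed

text \<open>Matching the blocks one by one shows that all balanced labellings with the same parameters are
isomorphic to the standard one, which is division by the block size.\<close>

lemma balanced_labelling_bij:
  assumes "balanced_labelling S \<alpha> n p"
  obtains \<phi> where "bij_betw \<phi> {..<n * p} S" "\<And>x. x < n * p \<Longrightarrow> \<alpha> (\<phi> x) = x div p"
proof -
  define fib where "fib a = {x\<in>S. \<alpha> x = a}" for a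
  have "\<exists>e. bij_betw e {..<p} (fib a)" if "a < n" for a
    using ex_bij_betw_nat_finite[of "fib a"] assms that
    unfolding balanced_labelling_def fib_def lessThan_atLeast0 by auto
  then obtain e where e: "\<And>a. a < n \<Longrightarrow> bij_betw (e a) {..<p} (fib a)" by metis
  define \<phi> where "\<phi> x = e (x div p) (x mod p)" for x
  have mem: "x div p < n \<and> x mod p < p" if "x < n * p" for x
    using that by (metis less_mult_imp_div_less mod_less_divisor mult_0_right not_gr_zero not_less_zero)
  have fib: "\<phi> x \<in> fib (x div p)" if "x < n * p" for x
    using mem[OF that] e unfolding \<phi>_def bij_betw_def by blast
  then have lab: "\<alpha> (\<phi> x) = x div p" if "x < n * p" for x using that by (simp add: fib_def)
  have "bij_betw \<phi> {..<n * p} S"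
  proof (rule bij_betwI')
    fix x y assume "x \<in> {..<n * p}" "y \<in> {..<n * p}"
    then have xy: "x < n * p" "y < n * p" by auto
    show "(\<phi> x = \<phi> y) = (x = y)"
    proof
      assume eq: "\<phi> x = \<phi> y"
      then have div: "x div p = y div p" using lab[OF xy(1)] lab[OF xy(2)] by simp
      moreover have "inj_on (e (y div p)) {..<p}" using e mem[OF xy(2)] by (simp add: bij_betw_def)
      ultimately have "x mod p = y mod p"
        using eq mem[OF xy(1)] mem[OF xy(2)] unfolding \<phi>_def inj_on_def by auto
      with div show "x = y" by (metis div_mult_mod_eq)
    qed simp
  next
    fix x assume "x \<in> {..<n * p}"
    then show "\<phi> x \<in> S" using fib by (auto simp: fib_def)
  next
    fix s assume s: "s \<in> S"
    then have a: "\<alpha> s < n" using assms by (simp add: balanced_labelling_def)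
    have "s \<in> e (\<alpha> s) ` {..<p}" using e[OF a] s by (simp add: bij_betw_def fib_def)
    then obtain j where j: "j < p" "s = e (\<alpha> s) j" by auto
    have "\<alpha> s * p + j < n * p"
    proof -
      have "\<alpha> s * p + j < Suc (\<alpha> s) * p" using j by simp
      also have "\<dots> \<le> n * p" using a by (intro mult_le_mono1) simp
      finally show ?thesis .
    qed
    then show "\<exists>x\<in>{..<n * p}. s = \<phi> x"
      using j by (intro bexI[of _ "\<alpha> s * p + j"]) (auto simp: \<phi>_def)
  qed
  then show ?thesis using that lab by blast
qed

text \<open>The labelling of \<open>q\<close> copies of \<open>S\<close> together with a separately labelled remainder \<open>R\<close>; the second
component of a pair numbers the copy, and the value \<open>q\<close> marks the remainder.\<close>

lemma balanced_labelling_extend: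
  assumes \<alpha>: "balanced_labelling S \<alpha> n p" and \<gamma>: "balanced_labelling R \<gamma> n p'"
  shows "balanced_labelling (S \<times> {..<q} \<union> R \<times> {q}) (\<lambda>x. if snd x < q then \<alpha> (fst x) else \<gamma> (fst x))
    n (q * p + p')"
proof -
  let ?\<alpha> = "\<lambda>x. if snd x < q then \<alpha> (fst x) else \<gamma> (fst x)"
  have "card {x \<in> S \<times> {..<q} \<union> R \<times> {q}. ?\<alpha> x = a} = q * p + p'" if "a < n" for a
  proof -
    have "{x \<in> S \<times> {..<q} \<union> R \<times> {q}. ?\<alpha> x = a}
        = {x\<in>S. \<alpha> x = a} \<times> {..<q} \<union> {x\<in>R. \<gamma> x = a} \<times> {q}" by auto
    also have "card \<dots> = card ({x\<in>S. \<alpha> x = a} \<times> {..<q}) + card ({x\<in>R. \<gamma> x = a} \<times> {q})"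
      by (rule card_Un_disjoint) (use \<alpha> \<gamma> in \<open>auto simp: balanced_labelling_def\<close>)
    also have "\<dots> = q * p + p'"
      using \<alpha> \<gamma> that by (simp add: balanced_labelling_def card_cartesian_product)
    finally show ?thesis .
  qed
  then show ?thesis using \<alpha> \<gamma> by (auto simp: balanced_labelling_def)
qed

section \<open>Comparison of ordered eigenvalues\<close>

text \<open>A square matrix with a zero row is singular, so it kills a nonzero vector.\<close>

lemma underdetermined_system:
  fixes a :: "nat \<Rightarrow> nat \<Rightarrow> 'a :: field"
  obtains c where "\<exists>j\<le>i. c j \<noteq> 0" "\<And>l. l < i \<Longrightarrow> (\<Sum>j\<le>i. a l j * c j) = 0"
proof -
  define M where "M = mat (Suc i) (Suc i) (\<lambda>(l, j). if l < i then a l j else 0)"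
  have M: "M \<in> carrier_mat (Suc i) (Suc i)" by (simp add: M_def)
  have "transpose_mat M *\<^sub>v unit_vec (Suc i) i = 0\<^sub>v (Suc i)"
    by (rule eq_vecI) (auto simp: M_def)
  moreover have "unit_vec (Suc i) i \<noteq> (0\<^sub>v (Suc i) :: 'a vec)"
    by (metis index_unit_vec(2) index_zero_vec(1) lessI zero_neq_one)
  ultimately have "det (transpose_mat M) = 0"
    using det_0_iff_vec_prod_zero_field[of "transpose_mat M" "Suc i"] M unit_vec_carrier
    by (metis transpose_carrier_mat)
  then have "det M = 0" using det_transpose[OF M] by simp
  then obtain v where v: "v \<in> carrier_vec (Suc i)" "v \<noteq> 0\<^sub>v (Suc i)" "M *\<^sub>v v = 0\<^sub>v (Suc i)"
    using det_0_iff_vec_prod_zero_field[OF M] by auto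
  have "\<exists>j\<le>i. v $ j \<noteq> 0"
  proof (rule ccontr)
    assume "\<not> ?thesis"
    then have "v = 0\<^sub>v (Suc i)" using v(1) by (intro eq_vecI) auto
    with v(2) show False by blast
  qed
  moreover have "(\<Sum>j\<le>i. a l j * v $ j) = 0" if "l < i" for l
  proof -
    have "(\<Sum>j\<le>i. a l j * v $ j) = (M *\<^sub>v v) $ l"
      using that v(1) by (auto simp: M_def scalar_prod_def lessThan_Suc_atMost[symmetric] lessThan_atLeast0
          intro!: sum.cong)
    then show ?thesis using v(3) that by simp
  qed
  ultimately show ?thesis using that[of "\<lambda>j. v $ j"] by blast
qed

text \<open>The Cauchy--Schwarz inequality against the constant function 1.\<close>

lemma norm_sum_power2_le:
  fixes v :: "'a \<Rightarrow> complex"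
  shows "(cmod (\<Sum>x\<in>F. v x))\<^sup>2 \<le> real (card F) * (\<Sum>x\<in>F. (cmod (v x))\<^sup>2)"
proof -
  have "(cmod (\<Sum>x\<in>F. v x))\<^sup>2 \<le> (\<Sum>x\<in>F. cmod (v x))\<^sup>2"
    by (intro power_mono norm_sum) simp
  also have "\<dots> = (\<Sum>x\<in>F. \<Sum>y\<in>F. cmod (v x) * cmod (v y))"
    by (simp add: power2_eq_square sum_product)
  also have "\<dots> \<le> (\<Sum>x\<in>F. \<Sum>y\<in>F. ((cmod (v x))\<^sup>2 + (cmod (v y))\<^sup>2) / 2)"
    using sum_squares_bound[of "cmod (v _)" "cmod (v _)"] by (intro sum_mono) (simp add: field_simps)
  also have "\<dots> = ((\<Sum>x\<in>F. \<Sum>y\<in>F. (cmod (v x))\<^sup>2) + (\<Sum>x\<in>F. \<Sum>y\<in>F. (cmod (v y))\<^sup>2)) / 2"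
    by (simp only: sum.distrib sum_divide_distrib[symmetric])
  also have "\<dots> = real (card F) * (\<Sum>x\<in>F. (cmod (v x))\<^sup>2)"
    by (simp add: sum_distrib_left[symmetric])
  finally show ?thesis .
qed

text \<open>The quadratic form of a blow-up at \<open>v\<close> is the original quadratic form at the vector of block sums.\<close>

lemma quadratic_form_over_labels:
  fixes v :: "'a \<Rightarrow> complex"
  assumes L: "balanced_labelling S \<alpha> n p"
  defines "y \<equiv> \<lambda>a. \<Sum>x\<in>{x\<in>S. \<alpha> x = a}. v x"
  shows "(\<Sum>x\<in>S. \<Sum>x'\<in>S. cnj (v x) * h (\<alpha> x) (\<alpha> x') * v x')
    = (\<Sum>a<n. \<Sum>b<n. cnj (y a) * h a b * y b)"
proof -
  have inner: "(\<Sum>x'\<in>S. h a (\<alpha> x') * v x') = (\<Sum>b<n. h a b * y b)" for a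
    unfolding sum_over_labels[OF L] y_def sum_distrib_left by (intro sum.cong) auto
  have "(\<Sum>x\<in>S. \<Sum>x'\<in>S. cnj (v x) * h (\<alpha> x) (\<alpha> x') * v x')
      = (\<Sum>x\<in>S. cnj (v x) * (\<Sum>b<n. h (\<alpha> x) b * y b))"
    by (simp only: mult.assoc sum_distrib_left[symmetric] inner)
  also have "\<dots> = (\<Sum>a<n. cnj (y a) * (\<Sum>b<n. h a b * y b))"
    unfolding sum_over_labels[OF L] y_def cnj_sum sum_distrib_right by (intro sum.cong) auto
  finally show ?thesis by (simp only: mult.assoc sum_distrib_left)
qed

text \<open>The vector \<open>v\<close> constructed here is a nonzero combination of the first \<open>i + 1\<close> eigenvectors of \<open>f\<close>,
spread over the blocks of \<open>\<alpha>\<close>, whose sums over the blocks of \<open>\<beta>\<close> are orthogonal to the first \<open>i\<close>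
eigenvectors of \<open>g\<close>. On \<open>v\<close> the form of \<open>f\<close> is at least \<open>p \<mu>\<^sub>i |v|\<^sup>2\<close>: since \<open>v\<close> is constant
on the blocks of \<open>\<alpha>\<close>, passing to block sums multiplies its squared norm by exactly \<open>p\<close>.
It need not be constant on those of \<open>\<beta>\<close>, so there the
Cauchy--Schwarz inequality only gives an upper bound for the norm of the block sums, and the form of
\<open>g\<close> is at most \<open>q \<nu>\<^sub>i |v|\<^sup>2\<close> only with \<open>\<nu>\<^sub>i\<close> replaced by its positive part.\<close>

lemma eigenvalue_comparison:
  fixes S :: "'a set"
  assumes E: "orthonormal_eigenbasis n f u \<mu>" and \<mu>: "\<And>j l. j \<le> l \<Longrightarrow> l < n \<Longrightarrow> \<mu> l \<le> \<mu> j"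
    and E': "orthonormal_eigenbasis m g w \<nu>" and \<nu>: "\<And>j l. j \<le> l \<Longrightarrow> l < m \<Longrightarrow> \<nu> l \<le> \<nu> j"
    and L: "balanced_labelling S \<alpha> n p" and L': "balanced_labelling S \<beta> m q" and p: "p > 0"
    and form: "\<And>v :: 'a \<Rightarrow> complex. Re (\<Sum>x\<in>S. \<Sum>y\<in>S. cnj (v x) * (f (\<alpha> x) (\<alpha> y) - g (\<beta> x) (\<beta> y)) * v y)
      \<le> R * (\<Sum>x\<in>S. (cmod (v x))\<^sup>2)"
    and i: "i < n" "i < m"
  shows "real p * \<mu> i \<le> real q * max (\<nu> i) 0 + R"
proof -
  \<comment> \<open>\<open>sys l j\<close>: the \<open>l\<close>-th coefficient, with respect to \<open>w\<close>, of the block sums of the spread-out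
    \<open>j\<close>-th eigenvector \<open>u j\<close>\<close>
  define sys where "sys l j = (\<Sum>b<m. cnj (w l b) * (\<Sum>x\<in>{x\<in>S. \<beta> x = b}. u j (\<alpha> x)))" for l j
  obtain c where c0: "\<exists>j\<le>i. c j \<noteq> 0" and sys0: "\<And>l. l < i \<Longrightarrow> (\<Sum>j\<le>i. sys l j * c j) = 0"
    using underdetermined_system[of i sys] by blast
  define z where "z a = (\<Sum>j\<le>i. c j * u j a)" for a
  define v where "v x = z (\<alpha> x)" for x
  define y where "y b = (\<Sum>x\<in>{x\<in>S. \<beta> x = b}. v x)" for b
  define d where "d l = (\<Sum>b<m. cnj (w l b) * y b)" for l
  have coeff: "(\<Sum>a<n. cnj (u j a) * z a) = (if j \<le> i then c j else 0)" if "j < n" for j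
  proof -
    have "(\<Sum>a<n. cnj (u j a) * z a) = (\<Sum>j'\<le>i. c j' * (\<Sum>a<n. cnj (u j a) * u j' a))"
      unfolding z_def sum_distrib_left
      by (subst sum.swap) (simp add: algebra_simps)
    also have "\<dots> = (\<Sum>j'\<le>i. if j = j' then c j' else 0)"
      using E that i by (intro sum.cong) (auto simp: orthonormal_eigenbasis_def)
    finally show ?thesis by simp
  qed
  have norm_z: "(\<Sum>a<n. (cmod (z a))\<^sup>2) = (\<Sum>j\<le>i. (cmod (c j))\<^sup>2)"
    by (subst orthonormal_parseval[OF E], rule sum.mono_neutral_cong_right) (use i in \<open>auto simp: coeff\<close>)
  have norm_pos: "(\<Sum>j\<le>i. (cmod (c j))\<^sup>2) > 0"
    using c0 by (auto intro!: sum_pos2)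
  have norm_v: "(\<Sum>x\<in>S. (cmod (v x))\<^sup>2) = p * (\<Sum>j\<le>i. (cmod (c j))\<^sup>2)"
    unfolding v_def using sum_of_label_function[OF L, of "\<lambda>a. (cmod (z a))\<^sup>2"] norm_z by simp
  have lower: "Re (\<Sum>x\<in>S. \<Sum>y\<in>S. cnj (v x) * f (\<alpha> x) (\<alpha> y) * v y)
      \<ge> p * \<mu> i * (\<Sum>x\<in>S. (cmod (v x))\<^sup>2)"
  proof -
    have block: "(\<Sum>x\<in>{x\<in>S. \<alpha> x = a}. v x) = of_nat p * z a" if "a < n" for a
    proof -
      have "(\<Sum>x\<in>{x\<in>S. \<alpha> x = a}. v x) = (\<Sum>x\<in>{x\<in>S. \<alpha> x = a}. z a)"
        unfolding v_def by (intro sum.cong) auto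
      then show ?thesis using L that by (simp add: balanced_labelling_def)
    qed
    have "(\<Sum>x\<in>S. \<Sum>y\<in>S. cnj (v x) * f (\<alpha> x) (\<alpha> y) * v y)
        = (\<Sum>a<n. \<Sum>b<n. (of_nat p)\<^sup>2 * (cnj (z a) * f a b * z b))"
      unfolding quadratic_form_over_labels[OF L]
      by (intro sum.cong) (auto simp: block power2_eq_square)
    also have "\<dots> = (of_nat p)\<^sup>2 * of_real (\<Sum>j<n. \<mu> j * (cmod (\<Sum>a<n. cnj (u j a) * z a))\<^sup>2)"
      by (simp only: sum_distrib_left[symmetric] quadratic_form_diagonal[OF E])
    also have "(\<Sum>j<n. \<mu> j * (cmod (\<Sum>a<n. cnj (u j a) * z a))\<^sup>2) = (\<Sum>j\<le>i. \<mu> j * (cmod (c j))\<^sup>2)"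
      using i by (intro sum.mono_neutral_cong_right) (auto simp: coeff)
    also have "(of_nat p)\<^sup>2 * complex_of_real (\<Sum>j\<le>i. \<mu> j * (cmod (c j))\<^sup>2)
        = complex_of_real ((real p)\<^sup>2 * (\<Sum>j\<le>i. \<mu> j * (cmod (c j))\<^sup>2))" by simp
    finally have "Re (\<Sum>x\<in>S. \<Sum>y\<in>S. cnj (v x) * f (\<alpha> x) (\<alpha> y) * v y)
        = (real p)\<^sup>2 * (\<Sum>j\<le>i. \<mu> j * (cmod (c j))\<^sup>2)"
      by (simp only: Re_complex_of_real)
    moreover have "\<mu> i * (\<Sum>j\<le>i. (cmod (c j))\<^sup>2) \<le> (\<Sum>j\<le>i. \<mu> j * (cmod (c j))\<^sup>2)"
      unfolding sum_distrib_left using i \<mu> by (intro sum_mono mult_right_mono) auto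
    then have "(real p)\<^sup>2 * (\<mu> i * (\<Sum>j\<le>i. (cmod (c j))\<^sup>2))
        \<le> (real p)\<^sup>2 * (\<Sum>j\<le>i. \<mu> j * (cmod (c j))\<^sup>2)"
      by (intro mult_left_mono) auto
    moreover have "p * \<mu> i * (p * (\<Sum>j\<le>i. (cmod (c j))\<^sup>2))
        = (real p)\<^sup>2 * (\<mu> i * (\<Sum>j\<le>i. (cmod (c j))\<^sup>2))"
      by (simp only: power2_eq_square ac_simps)
    ultimately show ?thesis unfolding norm_v by linarith
  qed
  have d0: "d l = 0" if "l < i" for l
  proof -
    have "d l = (\<Sum>j\<le>i. sys l j * c j)"
      unfolding d_def y_def v_def z_def sys_def sum_distrib_left sum_distrib_right
      by (subst sum.swap[of _ _ "{..i}"], intro sum.cong refl, subst sum.swap)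
        (auto simp: algebra_simps)
    then show ?thesis using sys0[OF that] by simp
  qed
  have upper: "Re (\<Sum>x\<in>S. \<Sum>y\<in>S. cnj (v x) * g (\<beta> x) (\<beta> y) * v y)
      \<le> q * max (\<nu> i) 0 * (\<Sum>x\<in>S. (cmod (v x))\<^sup>2)"
  proof -
    have "Re (\<Sum>x\<in>S. \<Sum>y\<in>S. cnj (v x) * g (\<beta> x) (\<beta> y) * v y) = (\<Sum>l<m. \<nu> l * (cmod (d l))\<^sup>2)"
      unfolding quadratic_form_over_labels[OF L'] y_def[symmetric] quadratic_form_diagonal[OF E']
        d_def by simp
    also have "\<dots> \<le> (\<Sum>l<m. max (\<nu> i) 0 * (cmod (d l))\<^sup>2)"
    proof (intro sum_mono)
      fix l assume "l \<in> {..<m}"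
      then show "\<nu> l * (cmod (d l))\<^sup>2 \<le> max (\<nu> i) 0 * (cmod (d l))\<^sup>2"
        using d0[of l] \<nu>[of i l] by (cases "l < i") (auto intro!: mult_right_mono)
    qed
    also have "\<dots> = max (\<nu> i) 0 * (\<Sum>b<m. (cmod (y b))\<^sup>2)"
      unfolding orthonormal_parseval[OF E', of y] d_def sum_distrib_left ..
    also have "\<dots> \<le> max (\<nu> i) 0 * (\<Sum>b<m. q * (\<Sum>x\<in>{x\<in>S. \<beta> x = b}. (cmod (v x))\<^sup>2))"
    proof (intro mult_left_mono sum_mono)
      fix b assume "b \<in> {..<m}"
      then show "(cmod (y b))\<^sup>2 \<le> q * (\<Sum>x\<in>{x\<in>S. \<beta> x = b}. (cmod (v x))\<^sup>2)"
        using norm_sum_power2_le[of v "{x\<in>S. \<beta> x = b}"] L' by (simp add: y_def balanced_labelling_def)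
    qed simp
    also have "\<dots> = q * max (\<nu> i) 0 * (\<Sum>x\<in>S. (cmod (v x))\<^sup>2)"
      unfolding sum_over_labels[OF L', of "\<lambda>x. (cmod (v x))\<^sup>2"] by (simp add: sum_distrib_left mult_ac)
    finally show ?thesis .
  qed
  have "p * \<mu> i * (\<Sum>x\<in>S. (cmod (v x))\<^sup>2) \<le> (q * max (\<nu> i) 0 + R) * (\<Sum>x\<in>S. (cmod (v x))\<^sup>2)"
  proof -
    have split: "(\<Sum>x\<in>S. \<Sum>y\<in>S. cnj (v x) * (f (\<alpha> x) (\<alpha> y) - g (\<beta> x) (\<beta> y)) * v y)
        = (\<Sum>x\<in>S. \<Sum>y\<in>S. cnj (v x) * f (\<alpha> x) (\<alpha> y) * v y)
          - (\<Sum>x\<in>S. \<Sum>y\<in>S. cnj (v x) * g (\<beta> x) (\<beta> y) * v y)"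
      by (simp only: right_diff_distrib left_diff_distrib sum_subtractf)
    show ?thesis
      using form[of v] lower upper unfolding split distrib_right minus_complex.sel by linarith
  qed
  moreover have "(\<Sum>x\<in>S. (cmod (v x))\<^sup>2) > 0" using norm_v norm_pos p by simp
  ultimately show ?thesis by simp
qed

section \<open>Cut bounds\<close>

text \<open>For a matrix indexed by \<open>S\<close> this says that its cut norm, before division by the number of entries,
is at most \<open>C\<close>.\<close>

definition cut_bounded :: "'a set \<Rightarrow> ('a \<Rightarrow> 'a \<Rightarrow> complex) \<Rightarrow> real \<Rightarrow> bool" where
  "cut_bounded S h C \<longleftrightarrow> (\<forall>X\<subseteq>S. \<forall>Y\<subseteq>S. cmod (\<Sum>x\<in>X. \<Sum>y\<in>Y. h x y) \<le> C)"

lemma cut_bounded_nonneg: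
  assumes "cut_bounded S h C"
  shows "C \<ge> 0"
  using assms[unfolded cut_bounded_def, rule_format, of "{}" "{}"] by simp

lemma cut_bounded_uminus:
  assumes "cut_bounded S h C"
  shows "cut_bounded S (\<lambda>x y. - h x y) C"
  using assms by (simp add: cut_bounded_def sum_negf)

lemma cut_bounded_cong:
  assumes "\<And>x y. x \<in> S \<Longrightarrow> y \<in> S \<Longrightarrow> h x y = h' x y"
  shows "cut_bounded S h C \<longleftrightarrow> cut_bounded S h' C"
proof -
  have "(\<Sum>x\<in>X. \<Sum>y\<in>Y. h x y) = (\<Sum>x\<in>X. \<Sum>y\<in>Y. h' x y)" if "X \<subseteq> S" "Y \<subseteq> S" for X Y
    using assms that by (intro sum.cong) auto
  then show ?thesis by (simp add: cut_bounded_def)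
qed

lemma cut_bounded_reindex:
  assumes "cut_bounded S h C" "bij_betw \<phi> T S"
  shows "cut_bounded T (\<lambda>x y. h (\<phi> x) (\<phi> y)) C"
  unfolding cut_bounded_def
proof (intro allI impI)
  fix X Y assume XY: "X \<subseteq> T" "Y \<subseteq> T"
  have inj: "inj_on \<phi> X" "inj_on \<phi> Y" using assms(2) XY by (meson bij_betw_def inj_on_subset)+
  have "(\<Sum>x\<in>X. \<Sum>y\<in>Y. h (\<phi> x) (\<phi> y)) = (\<Sum>x\<in>\<phi> ` X. \<Sum>y\<in>\<phi> ` Y. h x y)"
    by (simp add: sum.reindex[OF inj(1)] sum.reindex[OF inj(2)])
  moreover have "\<phi> ` X \<subseteq> S" "\<phi> ` Y \<subseteq> S" using assms(2) XY by (auto simp: bij_betw_def)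
  ultimately show "cmod (\<Sum>x\<in>X. \<Sum>y\<in>Y. h (\<phi> x) (\<phi> y)) \<le> C"
    using assms(1) by (simp add: cut_bounded_def)
qed

lemma cut_bounded_copies:
  assumes S: "finite S" and h: "cut_bounded S h C"
  shows "cut_bounded (S \<times> {..<q}) (\<lambda>x y. h (fst x) (fst y)) ((real q)\<^sup>2 * C)"
  unfolding cut_bounded_def
proof (intro allI impI)
  have layers: "(\<Sum>x\<in>X. F (fst x)) = (\<Sum>t<q. \<Sum>x\<in>{x\<in>S. (x, t) \<in> X}. F x)"
    if "X \<subseteq> S \<times> {..<q}" for X and F :: "'a \<Rightarrow> complex"
  proof -
    have "(\<Sum>t<q. \<Sum>x\<in>{x\<in>S. (x, t) \<in> X}. F x) = (\<Sum>(t, x)\<in>(SIGMA t:{..<q}. {x\<in>S. (x, t) \<in> X}). F x)"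
      using S by (subst sum.Sigma) auto
    also have "\<dots> = (\<Sum>x\<in>X. F (fst x))"
      by (rule sum.reindex_bij_witness[of _ "\<lambda>(x, t). (t, x)" "\<lambda>(t, x). (x, t)"]) (use that in auto)
    finally show ?thesis by simp
  qed
  fix X Y assume X: "X \<subseteq> S \<times> {..<q}" and Y: "Y \<subseteq> S \<times> {..<q}"
  define Xt where "Xt t = {x\<in>S. (x, t) \<in> X}" for t
  define Yt where "Yt t = {x\<in>S. (x, t) \<in> Y}" for t
  have "(\<Sum>x\<in>X. \<Sum>y\<in>Y. h (fst x) (fst y)) = (\<Sum>x\<in>X. \<Sum>s<q. \<Sum>y\<in>Yt s. h (fst x) y)"
    unfolding Yt_def by (rule sum.cong[OF refl], rule layers[OF Y])
  also have "\<dots> = (\<Sum>t<q. \<Sum>x\<in>Xt t. \<Sum>s<q. \<Sum>y\<in>Yt s. h x y)"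
    unfolding Xt_def by (rule layers[OF X])
  also have "\<dots> = (\<Sum>t<q. \<Sum>s<q. \<Sum>x\<in>Xt t. \<Sum>y\<in>Yt s. h x y)"
    by (rule sum.cong[OF refl], rule sum.swap)
  also have "cmod \<dots> \<le> (\<Sum>t<q. \<Sum>s<q. C)"
    by (rule order_trans[OF norm_sum], rule sum_mono, rule order_trans[OF norm_sum], rule sum_mono)
      (use h in \<open>auto simp: cut_bounded_def Xt_def Yt_def\<close>)
  finally show "cmod (\<Sum>x\<in>X. \<Sum>y\<in>Y. h (fst x) (fst y)) \<le> (real q)\<^sup>2 * C"
    by (simp add: power2_eq_square)
qed

lemma norm_block_sum_le:
  assumes "finite T" "X \<subseteq> U" "Y \<subseteq> V" "U \<subseteq> T" "V \<subseteq> T"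
    and "\<And>x y. x \<in> T \<Longrightarrow> y \<in> T \<Longrightarrow> cmod (h x y) \<le> b" "b \<ge> 0"
  shows "cmod (\<Sum>x\<in>X. \<Sum>y\<in>Y. h x y) \<le> b * (real (card U) * real (card V))"
proof -
  have "cmod (\<Sum>x\<in>X. \<Sum>y\<in>Y. h x y) \<le> (\<Sum>x\<in>X. \<Sum>y\<in>Y. b)"
    by (intro order_trans[OF norm_sum] sum_mono) (use assms in blast)
  also have "\<dots> = b * (real (card X) * real (card Y))" by simp
  also have "\<dots> \<le> b * (real (card U) * real (card V))"
    using assms by (intro mult_left_mono mult_mono of_nat_mono card_mono) (auto intro: finite_subset)
  finally show ?thesis .
qed

lemma cut_bounded_Un:
  assumes fin: "finite T1" "finite T2" and h: "cut_bounded T1 h C"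
    and b: "\<And>x y. x \<in> T1 \<union> T2 \<Longrightarrow> y \<in> T1 \<union> T2 \<Longrightarrow> cmod (h x y) \<le> b" "b \<ge> 0"
  shows "cut_bounded (T1 \<union> T2) h (C + 2 * b * (real (card T2) * real (card (T1 \<union> T2))))"
  unfolding cut_bounded_def
proof (intro allI impI)
  fix X Y assume XY: "X \<subseteq> T1 \<union> T2" "Y \<subseteq> T1 \<union> T2"
  let ?T = "T1 \<union> T2"
  have finXY: "finite X" "finite Y" using XY fin finite_subset by blast+
  have split: "sum F Z = sum F (Z \<inter> T1) + sum F (Z - T1)" if "finite Z" for Z and F :: "'a \<Rightarrow> complex"
    using sum.Int_Diff[OF that] by blast
  have "(\<Sum>x\<in>X. \<Sum>y\<in>Y. h x y) = (\<Sum>x\<in>X \<inter> T1. \<Sum>y\<in>Y \<inter> T1. h x y)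
      + (\<Sum>x\<in>X \<inter> T1. \<Sum>y\<in>Y - T1. h x y) + (\<Sum>x\<in>X - T1. \<Sum>y\<in>Y. h x y)"
    by (subst split[OF finXY(1)], subst split[OF finXY(2)]) (simp only: sum.distrib)
  also have "cmod \<dots> \<le> C + b * (real (card ?T) * real (card T2)) + b * (real (card T2) * real (card ?T))"
  proof (intro order_trans[OF norm_triangle_ineq] add_mono)
    show "cmod (\<Sum>x\<in>X \<inter> T1. \<Sum>y\<in>Y \<inter> T1. h x y) \<le> C" using h by (simp add: cut_bounded_def)
    show "cmod (\<Sum>x\<in>X \<inter> T1. \<Sum>y\<in>Y - T1. h x y) \<le> b * (real (card ?T) * real (card T2))"
      by (rule norm_block_sum_le[of ?T]) (use fin XY b in auto)
    show "cmod (\<Sum>x\<in>X - T1. \<Sum>y\<in>Y. h x y) \<le> b * (real (card T2) * real (card ?T))"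
      by (rule norm_block_sum_le[of ?T]) (use fin XY b in auto)
  qed
  finally show "cmod (\<Sum>x\<in>X. \<Sum>y\<in>Y. h x y) \<le> C + 2 * b * (real (card T2) * real (card ?T))"
    by (simp add: algebra_simps)
qed

section \<open>Quadratic forms under a cut bound\<close>

text \<open>The left-hand side is a convex function of the weights, so on the cube it is largest at a vertex,
that is, for weights 0 and 1. The offset \<open>a\<close> carries the contribution of the indices already
treated in the induction.\<close>

lemma weighted_sum_le_of_subset_sums_le:
  fixes g :: "'a \<Rightarrow> complex"
  assumes "finite S" "\<And>X. X \<subseteq> S \<Longrightarrow> cmod (a + (\<Sum>x\<in>X. g x)) \<le> C"
    "\<And>x. x \<in> S \<Longrightarrow> 0 \<le> t x \<and> t x \<le> (1::real)"
  shows "cmod (a + (\<Sum>x\<in>S. of_real (t x) * g x)) \<le> C"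
  using assms
proof (induction S arbitrary: a rule: finite_induct)
  case (insert x F)
  let ?r = "\<Sum>x\<in>F. of_real (t x) * g x"
  have 1: "cmod (a + ?r) \<le> C"
    using insert.prems by (intro insert.IH) auto
  have 2: "cmod ((a + g x) + ?r) \<le> C"
  proof (intro insert.IH)
    fix X assume "X \<subseteq> F"
    moreover from this have "(\<Sum>y\<in>insert x X. g y) = g x + (\<Sum>y\<in>X. g y)"
      using insert.hyps by (meson finite_subset in_mono sum.insert)
    ultimately show "cmod (a + g x + (\<Sum>x\<in>X. g x)) \<le> C"
      using insert.prems(1)[of "insert x X"] by (auto simp: add.assoc)
  qed (use insert.prems in auto)
  have t: "0 \<le> t x" "t x \<le> 1" using insert.prems(2)[of x] by auto
  have "a + (\<Sum>x\<in>insert x F. of_real (t x) * g x)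
      = of_real (1 - t x) * (a + ?r) + of_real (t x) * ((a + g x) + ?r)"
    using insert.hyps by (simp add: algebra_simps)
  also have "cmod \<dots> \<le> (1 - t x) * C + t x * C"
    using t 1 2 by (intro order_trans[OF norm_triangle_ineq] add_mono)
      (auto simp: norm_mult intro!: mult_left_mono simp del: of_real_diff)
  finally show ?case by (simp add: algebra_simps)
qed auto

text \<open>A complex number in the unit disc is a combination with coefficients \<open>1, -1, \<i>, -\<i>\<close> of four numbers
in the unit interval; this is where the factor 4 comes from.\<close>

lemma norm_weighted_sum_le:
  fixes g :: "'a \<Rightarrow> complex"
  assumes S: "finite S" and C: "\<And>X. X \<subseteq> S \<Longrightarrow> cmod (\<Sum>x\<in>X. g x) \<le> C"
    and z: "\<And>x. x \<in> S \<Longrightarrow> cmod (z x) \<le> 1"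
  shows "cmod (\<Sum>x\<in>S. z x * g x) \<le> 4 * C"
proof -
  define T where "T t = (\<Sum>x\<in>S. of_real (t x) * g x)" for t :: "'a \<Rightarrow> real"
  have T: "cmod (T t) \<le> C" if "\<And>x. x \<in> S \<Longrightarrow> 0 \<le> t x \<and> t x \<le> 1" for t
    unfolding T_def using weighted_sum_le_of_subset_sums_le[OF S, of 0 g C t] C that by simp
  define p1 where "p1 x = max (Re (z x)) 0" for x
  define p2 where "p2 x = max (- Re (z x)) 0" for x
  define p3 where "p3 x = max (Im (z x)) 0" for x
  define p4 where "p4 x = max (- Im (z x)) 0" for x
  have z_eq: "z x = of_real (p1 x) - of_real (p2 x) + \<i> * of_real (p3 x) - \<i> * of_real (p4 x)" for x
    by (auto simp: p1_def p2_def p3_def p4_def complex_eq_iff)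
  have "(\<Sum>x\<in>S. z x * g x) = T p1 - T p2 + \<i> * T p3 - \<i> * T p4"
    unfolding T_def z_eq sum_distrib_left sum.distrib[symmetric] sum_subtractf[symmetric]
    by (intro sum.cong) (auto simp: algebra_simps)
  also have "cmod \<dots> \<le> cmod (T p1) + cmod (T p2) + cmod (\<i> * T p3) + cmod (\<i> * T p4)"
    by (intro order_trans[OF norm_triangle_ineq4] order_trans[OF norm_triangle_ineq] add_mono order_refl)
  also have "\<dots> \<le> 4 * C"
  proof -
    have "\<bar>Re (z x)\<bar> \<le> 1" "\<bar>Im (z x)\<bar> \<le> 1" if "x \<in> S" for x
      using z[OF that] abs_Re_le_cmod[of "z x"] abs_Im_le_cmod[of "z x"] by auto
    then have "cmod (T p1) \<le> C" "cmod (T p2) \<le> C" "cmod (T p3) \<le> C" "cmod (T p4) \<le> C"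
      by (intro T; fastforce simp: p1_def p2_def p3_def p4_def)+
    then show ?thesis by (simp add: norm_mult)
  qed
  finally show ?thesis .
qed

text \<open>The passage from sets to complex weights costs a factor 4 for the rows and another one for the
columns. In terms of operators, the norm from \<open>\<ell>\<^sub>\<infinity>\<close> to \<open>\<ell>\<^sub>1\<close> is at most \<open>16 C\<close>.\<close>

lemma cut_bounded_bilinear_form:
  assumes S: "finite S" and C: "cut_bounded S h C"
    and y: "\<And>x. x \<in> S \<Longrightarrow> cmod (y x) \<le> 1" and z: "\<And>x. x \<in> S \<Longrightarrow> cmod (z x) \<le> 1"
  shows "cmod (\<Sum>x\<in>S. y x * (\<Sum>x'\<in>S. h x x' * z x')) \<le> 16 * C"
proof -
  have "cmod (\<Sum>x\<in>S. y x * (\<Sum>x'\<in>S. h x x' * z x')) \<le> 4 * (4 * C)"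
  proof (rule norm_weighted_sum_le[OF S _ y])
    fix X assume X: "X \<subseteq> S"
    have "(\<Sum>x\<in>X. \<Sum>x'\<in>S. h x x' * z x') = (\<Sum>x'\<in>S. z x' * (\<Sum>x\<in>X. h x x'))"
      by (subst sum.swap) (simp add: sum_distrib_left mult.commute)
    also have "cmod \<dots> \<le> 4 * C"
    proof (rule norm_weighted_sum_le[OF S _ z])
      fix Y assume "Y \<subseteq> S"
      then show "cmod (\<Sum>x'\<in>Y. \<Sum>x\<in>X. h x x') \<le> C"
        using C X by (subst sum.swap) (auto simp: cut_bounded_def)
    qed
    finally show "cmod (\<Sum>x\<in>X. \<Sum>x'\<in>S. h x x' * z x') \<le> 4 * C" .
  qed
  then show ?thesis by simp
qed

text \<open>With \<open>t = |x|\<^sub>\<infinity>\<close> and \<open>s = |x|\<^sub>1\<close>, the entry bound gives \<open>|\<mu>| t \<le> b s\<close> and the cut bound gives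
\<open>|\<mu>| s \<le> 16 C t\<close>. Multiplying the two inequalities eliminates the vector. Working
with an eigenvector thus replaces an interpolation between the two operator norms.\<close>

lemma eigenvalue_power2_le_cut_bound:
  fixes x :: "nat \<Rightarrow> complex" and \<mu> :: real
  assumes eig: "\<And>k. k < N \<Longrightarrow> (\<Sum>l<N. h k l * x l) = of_real \<mu> * x k"
    and nonzero: "\<exists>k<N. x k \<noteq> 0"
    and entries: "\<And>k l. k < N \<Longrightarrow> l < N \<Longrightarrow> cmod (h k l) \<le> b"
    and cut: "cut_bounded {..<N} h C"
  shows "\<mu>\<^sup>2 \<le> 16 * b * C"
proof -
  define s where "s = (\<Sum>k<N. cmod (x k))"
  define t where "t = Max ((\<lambda>k. cmod (x k)) ` {..<N})"
  obtain k0 where k0: "k0 < N" "x k0 \<noteq> 0" using nonzero by blast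
  have t_upper: "cmod (x k) \<le> t" if "k < N" for k unfolding t_def using that by (intro Max_ge) auto
  have "t \<in> (\<lambda>k. cmod (x k)) ` {..<N}" unfolding t_def using k0 by (intro Max_in) auto
  then obtain k1 where k1: "k1 < N" "t = cmod (x k1)" by auto
  have t_pos: "t > 0" using t_upper[of k0] k0 by (metis less_le_trans zero_less_norm_iff)
  have s_pos: "s > 0" unfolding s_def using k0 by (intro sum_pos2[of _ k0]) auto
  have "\<bar>\<mu>\<bar> * t = cmod (\<Sum>l<N. h k1 l * x l)" unfolding eig[OF k1(1)] k1(2) by (simp add: norm_mult)
  also have "\<dots> \<le> (\<Sum>l<N. b * cmod (x l))"
    using entries k1 by (intro order_trans[OF norm_sum] sum_mono) (auto simp: norm_mult intro!: mult_right_mono)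
  finally have 1: "\<bar>\<mu>\<bar> * t \<le> b * s" by (simp add: s_def sum_distrib_left)
  \<comment> \<open>with these weights the bilinear form evaluates to \<open>|\<mu>| s / t\<close>\<close>
  define y where "y k = cnj (sgn (of_real \<mu> * x k))" for k
  define z where "z k = x k / of_real t" for k
  have "cmod (\<Sum>k<N. y k * (\<Sum>l<N. h k l * z l)) \<le> 16 * C"
    using t_upper t_pos
    by (intro cut_bounded_bilinear_form cut) (auto simp: y_def z_def norm_divide norm_sgn)
  moreover have "(\<Sum>k<N. y k * (\<Sum>l<N. h k l * z l)) = of_real (\<bar>\<mu>\<bar> * s / t)"
  proof -
    have "y k * (\<Sum>l<N. h k l * z l) = of_real (\<bar>\<mu>\<bar> * cmod (x k) / t)" if "k < N" for k
    proof -
      have "(\<Sum>l<N. h k l * z l) = (of_real \<mu> * x k) / of_real t"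
        unfolding eig[OF that, symmetric] z_def by (simp add: sum_divide_distrib)
      moreover have "cnj (sgn w) * w = of_real (cmod w)" for w :: complex
        by (cases "w = 0")
          (simp_all add: sgn_eq mult.commute[of "cnj w"] complex_norm_square[symmetric] power2_eq_square)
      ultimately show ?thesis by (simp add: y_def norm_mult)
    qed
    then show ?thesis by (simp add: s_def sum_distrib_left sum_divide_distrib)
  qed
  ultimately have "\<bar>\<mu>\<bar> * s / t \<le> 16 * C" using t_pos s_pos by (simp add: norm_mult norm_divide)
  then have 2: "\<bar>\<mu>\<bar> * s \<le> 16 * C * t" using t_pos by (simp add: field_simps)
  have "(\<bar>\<mu>\<bar> * t) * (\<bar>\<mu>\<bar> * s) \<le> (b * s) * (16 * C * t)"
    using t_pos s_pos by (intro mult_mono[OF 1 2] order_trans[OF _ 1]) auto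
  then have "\<mu>\<^sup>2 * (s * t) \<le> (16 * b * C) * (s * t)"
    by (simp add: power2_eq_square mult_ac flip: abs_mult)
  then show ?thesis using s_pos t_pos by simp
qed

lemma hermitian_form_le_cut_bound:
  fixes h :: "nat \<Rightarrow> nat \<Rightarrow> complex"
  assumes herm: "\<And>k l. k < N \<Longrightarrow> l < N \<Longrightarrow> h l k = cnj (h k l)"
    and entries: "\<And>k l. k < N \<Longrightarrow> l < N \<Longrightarrow> cmod (h k l) \<le> b"
    and cut: "cut_bounded {..<N} h C"
  shows "Re (\<Sum>k<N. \<Sum>l<N. cnj (v k) * h k l * v l) \<le> sqrt (16 * b * C) * (\<Sum>k<N. (cmod (v k))\<^sup>2)"
proof -
  define D where "D = mat N N (\<lambda>(k, l). h k l)"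
  have D: "D \<in> carrier_mat N N" by (simp add: D_def)
  have "hermitian_mat D"
    unfolding hermitian_mat_iff[OF D]
  proof (intro allI impI)
    fix i j assume "i < N" "j < N"
    then show "D $$ (j, i) = cnj (D $$ (i, j))" using herm[of i j] by (simp add: D_def)
  qed
  then obtain u where E0: "orthonormal_eigenbasis N (\<lambda>k l. D $$ (k, l)) u (\<lambda>j. eigenvalue_list D ! j)"
    using hermitian_eigenbasis(3)[OF D] by blast
  define \<mu> where "\<mu> j = eigenvalue_list D ! j" for j
  have E: "orthonormal_eigenbasis N h u \<mu>"
    using E0 unfolding orthonormal_eigenbasis_def D_def \<mu>_def by simp
  have \<mu>: "\<mu> j \<le> sqrt (16 * b * C)" if "j < N" for j
  proof -
    have one: "(\<Sum>k<N. cnj (u j k) * u j k) = 1" using E that by (simp add: orthonormal_eigenbasis_def)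
    have nonzero: "\<exists>k<N. u j k \<noteq> 0"
    proof (rule ccontr)
      assume "\<not> ?thesis"
      then have "(\<Sum>k<N. cnj (u j k) * u j k) = 0" by simp
      with one show False by simp
    qed
    have "(\<mu> j)\<^sup>2 \<le> 16 * b * C"
    proof (rule eigenvalue_power2_le_cut_bound[OF _ nonzero entries cut])
      show "(\<Sum>l<N. h k l * u j l) = of_real (\<mu> j) * u j k" if "k < N" for k
        using E \<open>j < N\<close> that by (simp add: orthonormal_eigenbasis_def)
    qed
    then show ?thesis using real_le_rsqrt by blast
  qed
  define c where "c j = (\<Sum>l<N. cnj (u j l) * v l)" for j
  have "Re (\<Sum>k<N. \<Sum>l<N. cnj (v k) * h k l * v l) = (\<Sum>j<N. \<mu> j * (cmod (c j))\<^sup>2)"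
    unfolding quadratic_form_diagonal[OF E] c_def by simp
  also have "\<dots> \<le> (\<Sum>j<N. sqrt (16 * b * C) * (cmod (c j))\<^sup>2)"
    using \<mu> by (intro sum_mono mult_right_mono) auto
  also have "\<dots> = sqrt (16 * b * C) * (\<Sum>k<N. (cmod (v k))\<^sup>2)"
    unfolding orthonormal_parseval[OF E, of v] c_def sum_distrib_left ..
  finally show ?thesis .
qed

section \<open>The cut norm and optimal alignments\<close>

text \<open>\<^const>\<open>pick\<close> enumerates \<open>X\<close> increasingly, and submatrices are indexed through it.\<close>

lemma bij_betw_pick:
  assumes "finite X"
  shows "bij_betw (pick X) {0..<card X} X"
proof (rule bij_betwI')
  show "(pick X i = pick X j) = (i = j)" if "i \<in> {0..<card X}" "j \<in> {0..<card X}" for i j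
    using that pick_mono_le by (metis atLeastLessThan_iff linorder_neqE_nat nat_less_le)
  show "pick X i \<in> X" if "i \<in> {0..<card X}" for i using that pick_in_set_le by auto
  show "\<exists>i\<in>{0..<card X}. x = pick X i" if "x \<in> X" for x
  proof
    show "x = pick X (card {a\<in>X. a < x})" using pick_card_in_set[OF that] by simp
    have "{a\<in>X. a < x} \<subset> X" using that by auto
    then show "card {a\<in>X. a < x} \<in> {0..<card X}" using assms by (simp add: psubset_card_mono)
  qed
qed

lemma sum_mat_submatrix:
  assumes "X \<subseteq> {0..<dim_row M}" "Y \<subseteq> {0..<dim_col M}"
  shows "sum_mat (submatrix M X Y) = (\<Sum>x\<in>X. \<Sum>y\<in>Y. M $$ (x, y))"
proof -
  have X: "{i. i < dim_row M \<and> i \<in> X} = X" and Y: "{i. i < dim_col M \<and> i \<in> Y} = Y"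
    using assms by auto
  have fin: "finite X" "finite Y" using assms finite_subset by auto
  have "sum_mat (submatrix M X Y) = (\<Sum>i\<in>{0..<card X}. \<Sum>j\<in>{0..<card Y}. M $$ (pick X i, pick Y j))"
    unfolding sum_mat_def sum.cartesian_product
    by (intro sum.cong) (auto simp: submatrix_def X Y)
  also have "\<dots> = (\<Sum>i\<in>{0..<card X}. \<Sum>y\<in>Y. M $$ (pick X i, y))"
    by (rule sum.cong[OF refl], rule sum.reindex_bij_betw[OF bij_betw_pick[OF fin(2)]])
  also have "\<dots> = (\<Sum>x\<in>X. \<Sum>y\<in>Y. M $$ (x, y))"
    by (rule sum.reindex_bij_betw[OF bij_betw_pick[OF fin(1)]])
  finally show ?thesis .
qed

lemma cut_norm_le_iff:
  assumes M: "M \<in> carrier_mat N N" and N: "N > 0"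
  shows "cut_norm M \<le> c \<longleftrightarrow> cut_bounded {..<N} (\<lambda>x y. M $$ (x, y)) (c * (real N)\<^sup>2)"
proof -
  let ?S = "{1 / (real (dim_row M) * real (dim_col M)) * cmod (sum_mat (submatrix M X Y)) | X Y.
     X \<subseteq> {0..<dim_row M} \<and> Y \<subseteq> {0..<dim_col M}}"
  have eq: "?S = (\<lambda>(X, Y). cmod (\<Sum>x\<in>X. \<Sum>y\<in>Y. M $$ (x, y)) / (real N)\<^sup>2) ` (Pow {..<N} \<times> Pow {..<N})"
    (is "_ = ?T")
  proof -
    define a where "a X Y = 1 / (real (dim_row M) * real (dim_col M)) * cmod (sum_mat (submatrix M X Y))" for X Y
    define b where "b X Y = cmod (\<Sum>x\<in>X. \<Sum>y\<in>Y. M $$ (x, y)) / (real N)\<^sup>2" for X Y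
    have ab: "a X Y = b X Y" if "X \<subseteq> {..<N}" "Y \<subseteq> {..<N}" for X Y
      unfolding a_def b_def using that M by (subst sum_mat_submatrix) (auto simp: power2_eq_square)
    have "?S = {a X Y | X Y. X \<subseteq> {..<N} \<and> Y \<subseteq> {..<N}}"
      using M by (simp add: a_def lessThan_atLeast0)
    also have "\<dots> = {b X Y | X Y. X \<subseteq> {..<N} \<and> Y \<subseteq> {..<N}}"
      using ab by metis
    also have "\<dots> = (\<lambda>(X, Y). b X Y) ` (Pow {..<N} \<times> Pow {..<N})" by auto
    finally show ?thesis unfolding b_def .
  qed
  have "cut_norm M \<le> c \<longleftrightarrow> (\<forall>s\<in>?T. s \<le> c)"
    unfolding cut_norm_def eq by (subst Max_le_iff) auto
  also have "\<dots> \<longleftrightarrow> cut_bounded {..<N} (\<lambda>x y. M $$ (x, y)) (c * (real N)\<^sup>2)"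
    using N by (auto simp: cut_bounded_def divide_le_eq)
  finally show ?thesis .
qed

lemma permutation_conjugation_index:
  fixes M :: "complex mat"
  assumes \<pi>: "\<pi> permutes {0..<d}" and M: "M \<in> carrier_mat d d"
    and P: "P = mat d d (\<lambda>(i, j). if i = \<pi> j then 1 else 0)"
    and Q: "Q = mat d d (\<lambda>(i, j). if \<pi> i = j then 1 else 0)"
    and x: "x < d" and y: "y < d"
  shows "(P * M * Q) $$ (x, y) = M $$ (inv_into UNIV \<pi> x, inv_into UNIV \<pi> y)"
proof -
  have inv: "inv_into UNIV \<pi> z < d" if "z < d" for z using permutes_in_image[OF permutes_inv[OF \<pi>], of z] that by simp
  have iff: "\<pi> i = j \<longleftrightarrow> i = inv_into UNIV \<pi> j" for i j using permutes_inverses[OF \<pi>] by metis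
  have PM: "(P * M) $$ (x, j) = M $$ (inv_into UNIV \<pi> x, j)" if "j < d" for j
  proof -
    have "(P * M) $$ (x, j) = (\<Sum>i<d. P $$ (x, i) * M $$ (i, j))"
      using x that M by (simp add: P scalar_prod_def lessThan_atLeast0)
    also have "\<dots> = (\<Sum>i<d. (if i = inv_into UNIV \<pi> x then M $$ (i, j) else 0))"
      using x iff[of _ x] by (intro sum.cong) (auto simp: P eq_commute[of x])
    also have "\<dots> = M $$ (inv_into UNIV \<pi> x, j)" using inv[OF x] by simp
    finally show ?thesis .
  qed
  have "(R * Q) $$ (x, y) = (\<Sum>j<d. R $$ (x, j) * Q $$ (j, y))" if "R \<in> carrier_mat d d" for R
    using that x y by (simp add: Q scalar_prod_def lessThan_atLeast0)
  moreover have "P * M \<in> carrier_mat d d" using M by (auto simp: P)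
  ultimately have "(P * M * Q) $$ (x, y) = (\<Sum>j<d. (P * M) $$ (x, j) * Q $$ (j, y))" by blast
  also have "\<dots> = (\<Sum>j<d. (if j = inv_into UNIV \<pi> y then (P * M) $$ (x, j) else 0))"
    using y iff[of _ y] by (intro sum.cong) (auto simp: Q)
  also have "\<dots> = (P * M) $$ (x, inv_into UNIV \<pi> y)" using inv[OF y] by simp
  finally show ?thesis using PM[OF inv[OF y]] by simp
qed

text \<open>The inverse in the definition of the aligned distance is determined by the permutation, so that the
minimum there ranges over permutations only.\<close>

lemma permutation_mat_inverse:
  assumes \<pi>: "\<pi> permutes {0..<d}"
    and P: "P = mat d d (\<lambda>(i, j). if i = \<pi> j then (1 :: complex) else 0)"
    and Q: "Q \<in> carrier_mat d d"
  shows "inverts_mat P Q \<and> inverts_mat Q P \<longleftrightarrow> Q = mat d d (\<lambda>(i, j). if \<pi> i = j then 1 else 0)"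
proof -
  define Q' where "Q' = mat d d (\<lambda>(i, j). if \<pi> i = j then (1 :: complex) else 0)"
  have Pc: "P \<in> carrier_mat d d" and Q'c: "Q' \<in> carrier_mat d d" by (auto simp: P Q'_def)
  have PQ': "P * Q' = 1\<^sub>m d"
  proof (rule eq_matI)
    fix x y assume "x < dim_row (1\<^sub>m d :: complex mat)" "y < dim_col (1\<^sub>m d :: complex mat)"
    then have xy: "x < d" "y < d" by auto
    have "inv_into UNIV \<pi> z < d" if "z < d" for z using permutes_in_image[OF permutes_inv[OF \<pi>], of z] that by simp
    moreover have "inv_into UNIV \<pi> x = inv_into UNIV \<pi> y \<longleftrightarrow> x = y"
      using permutes_inj[OF permutes_inv[OF \<pi>]] by (simp add: inj_eq)
    moreover have "P * Q' = P * 1\<^sub>m d * Q'" using Pc by simp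
    ultimately show "(P * Q') $$ (x, y) = 1\<^sub>m d $$ (x, y)"
      using permutation_conjugation_index[OF \<pi> one_carrier_mat P Q'_def] xy by simp
  qed (use Pc Q'c in auto)
  have Q'P: "Q' * P = 1\<^sub>m d" by (rule mat_mult_left_right_inverse[OF Pc Q'c PQ'])
  have "Q = Q'" if "P * Q = 1\<^sub>m d"
  proof -
    have "Q = Q' * P * Q" using Q'P Q by simp
    also have "\<dots> = Q'" using Q'c Pc Q that by (simp add: assoc_mult_mat[of _ d d _ d _ d])
    finally show ?thesis .
  qed
  then show ?thesis using PQ' Q'P Pc Q'c Q by (auto simp: inverts_mat_def Q'_def[symmetric])
qed

text \<open>Conjugation by a permutation matrix relabels rows and columns simultaneously. The relabelling is by
the inverse permutation, which ranges over all permutations as well.\<close>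

lemma aligned_cut_distance_eq_Min:
  assumes M: "M \<in> carrier_mat d d" and N: "N \<in> carrier_mat d d"
  shows "aligned_cut_distance M N = Min ((\<lambda>\<pi>. cut_norm (mat d d (\<lambda>(x, y). M $$ (x, y) - N $$ (\<pi> x, \<pi> y))))
    ` {\<pi>. \<pi> permutes {0..<d}})"
proof -
  define F where "F \<pi> = mat d d (\<lambda>(x, y). M $$ (x, y) - N $$ (\<pi> x, \<pi> y))" for \<pi>
  define Pm where "Pm \<pi> = mat d d (\<lambda>(i, j). if i = \<pi> j then (1 :: complex) else 0)" for \<pi>
  define Qm where "Qm \<pi> = mat d d (\<lambda>(i, j). if \<pi> i = j then (1 :: complex) else 0)" for \<pi>
  have diff: "M - Pm \<pi> * N * Qm \<pi> = F (inv_into UNIV \<pi>)" if "\<pi> permutes {0..<d}" for \<pi>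
  proof (rule eq_matI)
    fix x y assume "x < dim_row (F (inv_into UNIV \<pi>))" "y < dim_col (F (inv_into UNIV \<pi>))"
    then have xy: "x < d" "y < d" by (auto simp: F_def)
    have "(Pm \<pi> * N * Qm \<pi>) $$ (x, y) = N $$ (inv_into UNIV \<pi> x, inv_into UNIV \<pi> y)"
      by (rule permutation_conjugation_index[OF that N Pm_def Qm_def xy])
    then show "(M - Pm \<pi> * N * Qm \<pi>) $$ (x, y) = F (inv_into UNIV \<pi>) $$ (x, y)"
      using xy M N by (simp add: F_def Pm_def Qm_def)
  qed (use M N in \<open>auto simp: F_def Pm_def Qm_def\<close>)
  have "{cut_norm (M - P * N * Q) | P Q.
     permutation_mat (dim_row M) P \<and> Q \<in> carrier_mat (dim_row M) (dim_row M) \<and>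
     inverts_mat P Q \<and> inverts_mat Q P}
     = {cut_norm (M - Pm \<pi> * N * Qm \<pi>) | \<pi>. \<pi> permutes {0..<d}}" (is "?L = ?R")
  proof (intro subset_antisym subsetI)
    fix s assume "s \<in> ?L"
    then obtain P Q \<pi> where s: "s = cut_norm (M - P * N * Q)" and \<pi>: "\<pi> permutes {0..<d}"
      and P: "P = Pm \<pi>" and Q: "Q \<in> carrier_mat d d" "inverts_mat P Q \<and> inverts_mat Q P"
      using M unfolding permutation_mat_def Pm_def by auto
    have "Q = Qm \<pi>" using permutation_mat_inverse[OF \<pi> P[unfolded Pm_def] Q(1)] Q(2) by (simp add: Qm_def)
    then show "s \<in> ?R" using s \<pi> P by auto
  next
    fix s assume "s \<in> ?R"
    then obtain \<pi> where s: "s = cut_norm (M - Pm \<pi> * N * Qm \<pi>)" and \<pi>: "\<pi> permutes {0..<d}" by auto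
    have Qc: "Qm \<pi> \<in> carrier_mat d d" by (simp add: Qm_def)
    have "inverts_mat (Pm \<pi>) (Qm \<pi>) \<and> inverts_mat (Qm \<pi>) (Pm \<pi>)"
      using permutation_mat_inverse[OF \<pi> Pm_def Qc] by (simp add: Qm_def)
    then show "s \<in> ?L" using s \<pi> Qc M unfolding permutation_mat_def Pm_def by fastforce
  qed
  also have "\<dots> = {cut_norm (F (inv_into UNIV \<pi>)) | \<pi>. \<pi> permutes {0..<d}}"
    using diff by metis
  also have "\<dots> = (\<lambda>\<pi>. cut_norm (F \<pi>)) ` {\<pi>. \<pi> permutes {0..<d}}"
    using permutes_inv permutes_inv_inv unfolding image_def by (metis (mono_tags, lifting) mem_Collect_eq)
  finally show ?thesis unfolding aligned_cut_distance_def F_def by simp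
qed

section \<open>Existence of the cut distance\<close>

lemma blow_up_carrier:
  assumes "M \<in> carrier_mat n n"
  shows "blow_up p M \<in> carrier_mat (n * p) (n * p)"
  using assms unfolding blow_up_def kronecker_product_def all_ones_mat_def carrier_mat_def by simp

lemma blow_up_index:
  assumes "M \<in> carrier_mat n n" "x < n * p" "y < n * p"
  shows "blow_up p M $$ (x, y) = M $$ (x div p, y div p)"
proof -
  have "p > 0" using assms(2) by (cases p) auto
  then show ?thesis
    using assms by (simp add: blow_up_def kronecker_product_def all_ones_mat_def)
qed

text \<open>The sequence whose limit is \<^const>\<open>cut_distance\<close>.\<close>

definition blow_up_distance :: "complex mat \<Rightarrow> complex mat \<Rightarrow> nat \<Rightarrow> real" where
  "blow_up_distance A B k = aligned_cut_distance (blow_up (k * dim_row B) A) (blow_up (k * dim_row A) B)"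

abbreviation labelled_difference ::
    "complex mat \<Rightarrow> complex mat \<Rightarrow> ('a \<Rightarrow> nat) \<Rightarrow> ('a \<Rightarrow> nat) \<Rightarrow> 'a \<Rightarrow> 'a \<Rightarrow> complex" where
  "labelled_difference A B \<alpha> \<beta> \<equiv> \<lambda>x y. A $$ (\<alpha> x, \<alpha> y) - B $$ (\<beta> x, \<beta> y)"

lemma blow_up_distance_eq_Min:
  assumes A: "A \<in> carrier_mat n n" and B: "B \<in> carrier_mat m m" and N: "N = n * (k * m)"
  shows "blow_up_distance A B k = Min ((\<lambda>\<pi>. cut_norm (mat N N (\<lambda>(x, y).
      labelled_difference A B (\<lambda>x. x div (k * m)) (\<lambda>x. \<pi> x div (k * n)) x y))) ` {\<pi>. \<pi> permutes {..<N}})"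
proof -
  have N': "N = m * (k * n)" using N by simp
  have dim: "dim_row A = n" "dim_row B = m" using A B by auto
  have "blow_up_distance A B k = Min ((\<lambda>\<pi>. cut_norm (mat N N (\<lambda>(x, y).
      blow_up (k * m) A $$ (x, y) - blow_up (k * n) B $$ (\<pi> x, \<pi> y)))) ` {\<pi>. \<pi> permutes {0..<N}})"
    unfolding blow_up_distance_def dim
    by (rule aligned_cut_distance_eq_Min)
      (use blow_up_carrier[OF A, of "k * m"] blow_up_carrier[OF B, of "k * n"] N N' in auto)
  also have "\<dots> = Min ((\<lambda>\<pi>. cut_norm (mat N N (\<lambda>(x, y).
      labelled_difference A B (\<lambda>x. x div (k * m)) (\<lambda>x. \<pi> x div (k * n)) x y))) ` {\<pi>. \<pi> permutes {..<N}})"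
  proof (intro arg_cong[of _ _ Min] image_cong)
    fix \<pi> assume "\<pi> \<in> {\<pi>. \<pi> permutes {..<N}}"
    then have \<pi>: "\<pi> x < N" if "x < N" for x using that permutes_in_image[of \<pi> "{..<N}" x] by simp
    have "blow_up (k * m) A $$ (x, y) - blow_up (k * n) B $$ (\<pi> x, \<pi> y)
        = labelled_difference A B (\<lambda>x. x div (k * m)) (\<lambda>x. \<pi> x div (k * n)) x y"
      if "x < N" "y < N" for x y
      using that \<pi> blow_up_index[OF A, of x "k * m" y, folded N]
        blow_up_index[OF B, of "\<pi> x" "k * n" "\<pi> y", folded N'] by simp
    then show "cut_norm (mat N N (\<lambda>(x, y). blow_up (k * m) A $$ (x, y) - blow_up (k * n) B $$ (\<pi> x, \<pi> y)))
      = cut_norm (mat N N (\<lambda>(x, y).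
          labelled_difference A B (\<lambda>x. x div (k * m)) (\<lambda>x. \<pi> x div (k * n)) x y))"
      by (intro arg_cong[of _ _ cut_norm] eq_matI) simp_all
  qed (simp add: lessThan_atLeast0)
  finally show ?thesis .
qed

lemma blow_up_distance_attained:
  assumes A: "A \<in> carrier_mat n n" and B: "B \<in> carrier_mat m m" and N: "N = n * (k * m)" "N > 0"
  obtains \<pi> where "\<pi> permutes {..<N}"
    "cut_bounded {..<N} (labelled_difference A B (\<lambda>x. x div (k * m)) (\<lambda>x. \<pi> x div (k * n)))
       (blow_up_distance A B k * (real N)\<^sup>2)"
proof -
  define F where "F \<pi> = mat N N (\<lambda>(x, y).
      labelled_difference A B (\<lambda>x. x div (k * m)) (\<lambda>x. \<pi> x div (k * n)) x y)" for \<pi>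
  have "finite {\<pi>. \<pi> permutes {..<N}}" by (simp add: finite_permutations)
  moreover have "{\<pi>. \<pi> permutes {..<N}} \<noteq> {}" using permutes_id by blast
  ultimately have "blow_up_distance A B k \<in> (\<lambda>\<pi>. cut_norm (F \<pi>)) ` {\<pi>. \<pi> permutes {..<N}}"
    unfolding blow_up_distance_eq_Min[OF A B N(1)] F_def by (intro Min_in) auto
  then obtain \<pi> where \<pi>: "\<pi> permutes {..<N}" "cut_norm (F \<pi>) = blow_up_distance A B k" by auto
  have "cut_bounded {..<N} (\<lambda>x y. F \<pi> $$ (x, y)) (blow_up_distance A B k * (real N)\<^sup>2)"
    using cut_norm_le_iff[of "F \<pi>" N "blow_up_distance A B k"] \<pi>(2) N(2) by (simp add: F_def)
  then have "cut_bounded {..<N} (labelled_difference A B (\<lambda>x. x div (k * m)) (\<lambda>x. \<pi> x div (k * n)))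
       (blow_up_distance A B k * (real N)\<^sup>2)"
    by (subst cut_bounded_cong[where h' = "\<lambda>x y. F \<pi> $$ (x, y)"]) (auto simp: F_def)
  with \<pi>(1) show ?thesis by (rule that)
qed

text \<open>Together with \<open>blow_up_distance_attained\<close> this frees the alignment from the particular order of
the indices: every pair of balanced labellings of a common set is a competitor in the minimum.
Identify the set with the standard index set through \<open>\<alpha>\<close>, and a second time through \<open>\<beta>\<close>; the two
identifications differ by a permutation.\<close>

lemma blow_up_distance_le:
  assumes A: "A \<in> carrier_mat n n" and B: "B \<in> carrier_mat m m" and N: "N = n * (k * m)" "N > 0"
    and \<alpha>: "balanced_labelling S \<alpha> n (k * m)" and \<beta>: "balanced_labelling S \<beta> m (k * n)"
    and cut: "cut_bounded S (labelled_difference A B \<alpha> \<beta>) (c * (real N)\<^sup>2)"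
  shows "blow_up_distance A B k \<le> c"
proof -
  have N': "N = m * (k * n)" using N by simp
  obtain \<phi> where \<phi>: "bij_betw \<phi> {..<N} S" and \<alpha>\<phi>: "\<And>x. x < N \<Longrightarrow> \<alpha> (\<phi> x) = x div (k * m)"
    using balanced_labelling_bij[OF \<alpha>] unfolding N(1) by metis
  obtain \<psi> where \<psi>: "bij_betw \<psi> {..<N} S" and \<beta>\<psi>: "\<And>x. x < N \<Longrightarrow> \<beta> (\<psi> x) = x div (k * n)"
    using balanced_labelling_bij[OF \<beta>] unfolding N' by metis
  \<comment> \<open>\<open>\<pi>\<close> compares the two identifications of \<open>S\<close>; outside the index set it is the identity, as
    required of a permutation of that set\<close>
  define \<pi> where "\<pi> x = (if x < N then the_inv_into {..<N} \<psi> (\<phi> x) else x)" for x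
  have bij: "bij_betw (\<lambda>x. the_inv_into {..<N} \<psi> (\<phi> x)) {..<N} {..<N}"
    using bij_betw_trans[OF \<phi> bij_betw_the_inv_into[OF \<psi>]] by (simp add: o_def)
  have \<pi>: "\<pi> permutes {..<N}"
  proof (rule bij_imp_permutes)
    show "bij_betw \<pi> {..<N} {..<N}"
      using bij by (rule iffD1[OF bij_betw_cong, rotated]) (simp add: \<pi>_def)
  qed (simp add: \<pi>_def)
  have \<beta>\<phi>: "\<beta> (\<phi> x) = \<pi> x div (k * n)" if "x < N" for x
  proof -
    have "\<psi> (\<pi> x) = \<phi> x"
      using that \<phi> \<psi> f_the_inv_into_f_bij_betw[OF \<psi>, of "\<phi> x"] by (auto simp: \<pi>_def bij_betw_def)
    moreover have "\<pi> x < N" using permutes_in_image[OF \<pi>, of x] that by simp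
    ultimately show ?thesis using \<beta>\<psi>[of "\<pi> x"] by simp
  qed
  define F where "F \<pi> = mat N N (\<lambda>(x, y).
      labelled_difference A B (\<lambda>x. x div (k * m)) (\<lambda>x. \<pi> x div (k * n)) x y)" for \<pi>
  have "cut_bounded {..<N} (\<lambda>x y. labelled_difference A B \<alpha> \<beta> (\<phi> x) (\<phi> y)) (c * (real N)\<^sup>2)"
    by (rule cut_bounded_reindex[OF cut \<phi>])
  then have "cut_bounded {..<N} (\<lambda>x y. F \<pi> $$ (x, y)) (c * (real N)\<^sup>2)"
    by (subst (asm) cut_bounded_cong[where h' = "\<lambda>x y. F \<pi> $$ (x, y)"]) (auto simp: F_def \<alpha>\<phi> \<beta>\<phi>)
  then have "cut_norm (F \<pi>) \<le> c"
    using cut_norm_le_iff[of "F \<pi>" N c] N(2) by (simp add: F_def)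
  moreover have "blow_up_distance A B k \<le> cut_norm (F \<pi>)"
    unfolding blow_up_distance_eq_Min[OF A B N(1)] F_def
    by (rule Min_le) (use \<pi> in \<open>auto simp: finite_permutations\<close>)
  ultimately show ?thesis by simp
qed

lemma blow_up_distance_nonneg:
  assumes A: "A \<in> carrier_mat n n" and B: "B \<in> carrier_mat m m" and pos: "n > 0" "m > 0" "k > 0"
  shows "blow_up_distance A B k \<ge> 0"
proof -
  define N where "N = n * (k * m)"
  have N: "N > 0" using pos by (simp add: N_def)
  obtain \<pi> where "cut_bounded {..<N} (labelled_difference A B (\<lambda>x. x div (k * m)) (\<lambda>x. \<pi> x div (k * n)))
       (blow_up_distance A B k * (real N)\<^sup>2)"
    using blow_up_distance_attained[OF A B N_def N] by blast
  then have "0 \<le> blow_up_distance A B k * (real N)\<^sup>2"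
    by (rule cut_bounded_nonneg)
  then show ?thesis using N by (simp add: zero_le_mult_iff)
qed

text \<open>Take \<open>q\<close> copies of an optimal pair of labellings for \<open>k\<close> and fill up with any pair of
balanced labellings of \<open>n r m\<close> further indices. Each of the \<open>q\<^sup>2\<close> pairs of copies contributes at
most \<open>N\<^sup>2 d\<^sub>k\<close>, so that these add up to at most \<open>q\<^sup>2 N\<^sup>2 d\<^sub>k \<le> N'\<^sup>2 d\<^sub>k\<close>. The rows and the columns of the remainder each contain
\<open>n r m \<cdot> N'\<close> entries, which is the proportion \<open>r / k'\<close> of all, and every entry has modulus at most 2;
so they add at most \<open>4 r / k'\<close> to the normalised sum.\<close>

lemma blow_up_distance_step:
  fixes k k' q r :: nat
  assumes A: "A \<in> carrier_mat n n" and B: "B \<in> carrier_mat m m" and pos: "n > 0" "m > 0" "k > 0"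
    and A1: "\<And>i j. i < n \<Longrightarrow> j < n \<Longrightarrow> cmod (A $$ (i, j)) \<le> 1"
    and B1: "\<And>i j. i < m \<Longrightarrow> j < m \<Longrightarrow> cmod (B $$ (i, j)) \<le> 1"
    and k': "k' = q * k + r" "k' > 0"
  shows "blow_up_distance A B k' \<le> blow_up_distance A B k + 4 * real r / real k'"
proof -
  define N where "N = n * (k * m)"
  define N' where "N' = n * (k' * m)"
  have N: "N > 0" and N': "N' > 0" using pos k' by (simp_all add: N_def N'_def)
  obtain \<pi> where \<pi>: "\<pi> permutes {..<N}"
    and cut: "cut_bounded {..<N} (labelled_difference A B (\<lambda>x. x div (k * m)) (\<lambda>x. \<pi> x div (k * n)))
       (blow_up_distance A B k * (real N)\<^sup>2)"
    using blow_up_distance_attained[OF A B N_def N] by blast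
  define T1 where "T1 = {..<N} \<times> {..<q}"
  define T2 where "T2 = {..<n * (r * m)} \<times> {q}"
  define \<alpha> where "\<alpha> x = (if snd x < q then fst x div (k * m) else fst x div (r * m))" for x :: "nat \<times> nat"
  define \<beta> where "\<beta> x = (if snd x < q then \<pi> (fst x) div (k * n) else fst x div (r * n))" for x :: "nat \<times> nat"
  have \<alpha>: "balanced_labelling (T1 \<union> T2) \<alpha> n (k' * m)"
    using balanced_labelling_extend[OF balanced_labelling_div[of n "k * m"] balanced_labelling_div[of n "r * m"], of q]
    unfolding T1_def T2_def \<alpha>_def N_def k' by (simp add: algebra_simps)
  have \<beta>: "balanced_labelling (T1 \<union> T2) \<beta> m (k' * n)"
  proof -
    have "balanced_labelling {..<N} (\<lambda>x. \<pi> x div (k * n)) m (k * n)"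
      using balanced_labelling_permute[OF _ \<pi>, of "\<lambda>x. x div (k * n)" m "k * n"]
        balanced_labelling_div[of m "k * n"] by (simp add: N_def mult_ac)
    moreover have "balanced_labelling {..<n * (r * m)} (\<lambda>x. x div (r * n)) m (r * n)"
      using balanced_labelling_div[of m "r * n"] by (simp add: mult_ac)
    ultimately show ?thesis
      using balanced_labelling_extend[of "{..<N}" "\<lambda>x. \<pi> x div (k * n)" m "k * n"
          "{..<n * (r * m)}" "\<lambda>x. x div (r * n)" "r * n" q]
      unfolding T1_def T2_def \<beta>_def k' by (simp add: algebra_simps)
  qed
  let ?h = "labelled_difference A B \<alpha> \<beta>"
  have "cut_bounded T1 (\<lambda>x y. labelled_difference A B (\<lambda>x. x div (k * m)) (\<lambda>x. \<pi> x div (k * n)) (fst x) (fst y))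
      ((real q)\<^sup>2 * (blow_up_distance A B k * (real N)\<^sup>2))"
    unfolding T1_def by (rule cut_bounded_copies[OF _ cut]) simp
  then have cut1: "cut_bounded T1 ?h ((real q)\<^sup>2 * (blow_up_distance A B k * (real N)\<^sup>2))"
    by (subst cut_bounded_cong[where h' = "\<lambda>x y. labelled_difference A B (\<lambda>x. x div (k * m)) (\<lambda>x. \<pi> x div (k * n)) (fst x) (fst y)"])
      (auto simp: T1_def \<alpha>_def \<beta>_def)
  have entries: "cmod (?h x y) \<le> 2" if "x \<in> T1 \<union> T2" "y \<in> T1 \<union> T2" for x y
  proof -
    have "\<alpha> x < n" "\<alpha> y < n" "\<beta> x < m" "\<beta> y < m"
      using that \<alpha> \<beta> by (auto simp: balanced_labelling_def)
    then have "cmod (A $$ (\<alpha> x, \<alpha> y)) + cmod (B $$ (\<beta> x, \<beta> y)) \<le> 1 + 1"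
      by (intro add_mono A1 B1)
    then show ?thesis by (intro order_trans[OF norm_triangle_ineq4]) simp
  qed
  have fin: "finite T1" "finite T2" by (auto simp: T1_def T2_def)
  have card: "card (T1 \<union> T2) = N'" using balanced_labelling_card[OF \<alpha>] by (simp add: N'_def)
  have card2: "card T2 = n * (r * m)" by (simp add: T2_def card_cartesian_product)
  have "cut_bounded (T1 \<union> T2) ?h
      ((real q)\<^sup>2 * (blow_up_distance A B k * (real N)\<^sup>2) + 2 * 2 * (real (card T2) * real (card (T1 \<union> T2))))"
    by (rule cut_bounded_Un[OF fin cut1 entries]) auto
  moreover have "(real q)\<^sup>2 * (blow_up_distance A B k * (real N)\<^sup>2) + 2 * 2 * (real (card T2) * real (card (T1 \<union> T2)))
      \<le> (blow_up_distance A B k + 4 * real r / real k') * (real N')\<^sup>2"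
  proof -
    have "q * N \<le> N'" unfolding N_def N'_def k' by (simp add: algebra_simps)
    then have "real q * real N \<le> real N'" by (metis of_nat_le_iff of_nat_mult)
    then have "(real q * real N)\<^sup>2 \<le> (real N')\<^sup>2" by (intro power_mono) auto
    then have "blow_up_distance A B k * (real q * real N)\<^sup>2 \<le> blow_up_distance A B k * (real N')\<^sup>2"
      by (intro mult_left_mono blow_up_distance_nonneg[OF A B pos])
    moreover have "4 * real r / real k' * (real N')\<^sup>2 = 2 * 2 * (real (card T2) * real (card (T1 \<union> T2)))"
      unfolding card card2 using k'(2) by (simp add: N'_def power2_eq_square field_simps)
    ultimately show ?thesis by (simp add: algebra_simps power_mult_distrib)
  qed
  ultimately have "cut_bounded (T1 \<union> T2) ?h ((blow_up_distance A B k + 4 * real r / real k') * (real N')\<^sup>2)"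
    unfolding cut_bounded_def by (meson order_trans)
  then show ?thesis by (rule blow_up_distance_le[OF A B N'_def N' \<alpha> \<beta>])
qed

text \<open>The limit is the infimum: once \<open>f k\<close> is close to it, so are all sufficiently late terms, by division with
remainder by \<open>k\<close>.\<close>

lemma convergent_of_almost_decreasing_along_multiples:
  fixes f :: "nat \<Rightarrow> real"
  assumes nonneg: "\<And>k. k > 0 \<Longrightarrow> f k \<ge> 0"
    and step: "\<And>k q r. k > 0 \<Longrightarrow> q * k + r > 0 \<Longrightarrow> f (q * k + r) \<le> f k + c * real r / real (q * k + r)"
    and c: "c \<ge> 0"
  shows "convergent f"
proof -
  define I where "I = Inf (f ` {0<..})"
  have bdd: "bdd_below (f ` {0<..})" using nonneg by (intro bdd_belowI[of _ 0]) auto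
  have lower: "I \<le> f k" if "k > 0" for k
    unfolding I_def using bdd that by (intro cInf_lower) auto
  have "f \<longlonglongrightarrow> I"
  proof (rule LIMSEQ_I)
    fix e :: real assume e: "e > 0"
    have "Inf (f ` {0<..}) < I + e / 2" using e by (simp add: I_def)
    then obtain k where k: "k > 0" "f k < I + e / 2"
      using cInf_less_iff[OF _ bdd, of "I + e / 2"] by (auto simp: image_iff)
    \<comment> \<open>beyond \<open>K\<close> the error \<open>c r / k'\<close> is below \<open>e / 2\<close> for every remainder \<open>r < k\<close>\<close>
    obtain K where K: "real K > 2 * c * k / e" using reals_Archimedean2 by blast
    show "\<exists>K. \<forall>k'\<ge>K. norm (f k' - I) < e"
    proof (intro exI[of _ "max 1 K"] allI impI)
      fix k' assume k': "k' \<ge> max 1 K"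
      have "c * (k' mod k) / k' \<le> c * k / k'"
        using k c by (intro divide_right_mono mult_left_mono) auto
      also have "c * k / k' < e / 2"
      proof -
        have "2 * c * k / e < real k'" using K k' by linarith
        then show ?thesis using e k' by (simp add: field_simps)
      qed
      finally have "c * (k' mod k) / k' < e / 2" .
      moreover have "f k' \<le> f k + c * (k' mod k) / k'"
        using step[of k "k' div k" "k' mod k"] k k' unfolding div_mult_mod_eq by simp
      ultimately have "f k' < I + e" using k by linarith
      then show "norm (f k' - I) < e" using lower[of k'] k' e by auto
    qed
  qed
  then show ?thesis by (rule convergentI)
qed

lemma blow_up_distance_LIMSEQ:
  assumes A: "A \<in> carrier_mat n n" and B: "B \<in> carrier_mat m m" and pos: "n > 0" "m > 0"
    and A1: "\<And>i j. i < n \<Longrightarrow> j < n \<Longrightarrow> cmod (A $$ (i, j)) \<le> 1"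
    and B1: "\<And>i j. i < m \<Longrightarrow> j < m \<Longrightarrow> cmod (B $$ (i, j)) \<le> 1"
  shows "blow_up_distance A B \<longlonglongrightarrow> cut_distance A B"
proof -
  have "convergent (blow_up_distance A B)"
  proof (rule convergent_of_almost_decreasing_along_multiples[where c = 4])
    fix k q r :: nat assume kqr: "k > 0" "q * k + r > 0"
    show "blow_up_distance A B (q * k + r) \<le> blow_up_distance A B k + 4 * real r / real (q * k + r)"
      by (rule blow_up_distance_step[OF A B pos]) (use kqr A1 B1 in auto)
  qed (use blow_up_distance_nonneg[OF A B pos] in auto)
  moreover have "cut_distance A B = lim (blow_up_distance A B)"
    unfolding cut_distance_def blow_up_distance_def[abs_def] ..
  ultimately show ?thesis by (metis convergent_LIMSEQ_iff)
qed

section \<open>Eigenvalues and the cut distance\<close>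

text \<open>The two principles combined. The entries of the difference have modulus at most 2, which produces
\<open>sqrt (16 \<cdot> 2) \<le> 6\<close>; the block sizes \<open>km\<close> and \<open>kn\<close> cancel against \<open>N\<close> and leave the two
normalisations \<open>1/n\<close> and \<open>1/m\<close>.\<close>

lemma eigenvalue_comparison_cut_bounded:
  assumes E: "orthonormal_eigenbasis n f u \<mu>" and \<mu>: "\<And>j l. j \<le> l \<Longrightarrow> l < n \<Longrightarrow> \<mu> l \<le> \<mu> j"
    and E': "orthonormal_eigenbasis m g w \<nu>" and \<nu>: "\<And>j l. j \<le> l \<Longrightarrow> l < m \<Longrightarrow> \<nu> l \<le> \<nu> j"
    and f: "\<And>a b. a < n \<Longrightarrow> b < n \<Longrightarrow> f b a = cnj (f a b) \<and> cmod (f a b) \<le> 1"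
    and g: "\<And>a b. a < m \<Longrightarrow> b < m \<Longrightarrow> g b a = cnj (g a b) \<and> cmod (g a b) \<le> 1"
    and N: "N = n * (k * m)" and k: "k > 0"
    and \<alpha>: "balanced_labelling {..<N} \<alpha> n (k * m)" and \<beta>: "balanced_labelling {..<N} \<beta> m (k * n)"
    and cut: "cut_bounded {..<N} (\<lambda>x y. f (\<alpha> x) (\<alpha> y) - g (\<beta> x) (\<beta> y)) (c * (real N)\<^sup>2)"
    and i: "i < n" "i < m"
  shows "\<mu> i / n \<le> max (\<nu> i / m) 0 + 6 * sqrt c"
proof -
  let ?h = "\<lambda>x y. f (\<alpha> x) (\<alpha> y) - g (\<beta> x) (\<beta> y)"
  have lab: "\<alpha> x < n" "\<beta> x < m" if "x < N" for x
    using \<alpha> \<beta> that by (auto simp: balanced_labelling_def)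
  have herm: "?h y x = cnj (?h x y)" if "x < N" "y < N" for x y
    using f[OF lab(1)[OF that(1)] lab(1)[OF that(2)]] g[OF lab(2)[OF that(1)] lab(2)[OF that(2)]] by simp
  have entries: "cmod (?h x y) \<le> 2" if "x < N" "y < N" for x y
    using f[OF lab(1)[OF that(1)] lab(1)[OF that(2)]] g[OF lab(2)[OF that(1)] lab(2)[OF that(2)]]
      norm_triangle_ineq4[of "f (\<alpha> x) (\<alpha> y)" "g (\<beta> x) (\<beta> y)"] by simp
  have N0: "N > 0" using i k N by simp
  have c: "c \<ge> 0"
    using cut_bounded_nonneg[OF cut] N0 by (simp add: zero_le_mult_iff)
  have "real (k * m) * \<mu> i \<le> real (k * n) * max (\<nu> i) 0 + sqrt (16 * 2 * (c * (real N)\<^sup>2))"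
  proof (rule eigenvalue_comparison[OF E \<mu> E' \<nu> \<alpha> \<beta>])
    show "Re (\<Sum>x<N. \<Sum>y<N. cnj (v x) * ?h x y * v y)
        \<le> sqrt (16 * 2 * (c * (real N)\<^sup>2)) * (\<Sum>x<N. (cmod (v x))\<^sup>2)" for v
      by (rule hermitian_form_le_cut_bound[OF herm entries cut])
  qed (use i k in auto)
  also have "sqrt (16 * 2 * (c * (real N)\<^sup>2)) \<le> 6 * sqrt c * N"
  proof (rule real_le_lsqrt)
    show "16 * 2 * (c * (real N)\<^sup>2) \<le> (6 * sqrt c * real N)\<^sup>2"
      using c by (simp add: power_mult_distrib mult_right_mono)
  qed (use c in simp)
  finally have *: "real (k * m) * \<mu> i \<le> real (k * n) * max (\<nu> i) 0 + 6 * sqrt c * N" by simp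
  have "\<mu> i / n = real (k * m) * \<mu> i / N" using N k i by simp
  also have "\<dots> \<le> (real (k * n) * max (\<nu> i) 0 + 6 * sqrt c * N) / N"
    using * by (intro divide_right_mono) auto
  also have "\<dots> = max (\<nu> i) 0 / m + 6 * sqrt c"
    using N k i by (simp add: add_divide_distrib)
  also have "max (\<nu> i) 0 / m = max (\<nu> i / m) 0"
    using i by (simp add: max_def zero_le_divide_iff divide_le_0_iff)
  finally show ?thesis .
qed

text \<open>The limit of the comparisons for fixed \<open>k\<close>, for both orders of the two matrices and for their
negatives.\<close>

lemma eigenvalue_comparison_cut_distance:
  assumes pos: "n > 0" "m > 0"
    and A: "A \<in> carrier_mat n n" "hermitian_mat A"
    and B: "B \<in> carrier_mat m m" "hermitian_mat B"
    and A1: "\<And>i j. i < n \<Longrightarrow> j < n \<Longrightarrow> cmod (A $$ (i, j)) \<le> 1"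
    and B1: "\<And>i j. i < m \<Longrightarrow> j < m \<Longrightarrow> cmod (B $$ (i, j)) \<le> 1"
    and i: "i < n" "i < m"
  defines "\<mu> \<equiv> \<lambda>j. eigenvalue_list A ! j" and "\<nu> \<equiv> \<lambda>j. eigenvalue_list B ! j"
  shows "\<mu> i / n \<le> max (\<nu> i / m) 0 + 6 * sqrt (cut_distance A B)" (is ?AB)
    and "\<nu> i / m \<le> max (\<mu> i / n) 0 + 6 * sqrt (cut_distance A B)" (is ?BA)
    and "- \<mu> (n - 1 - i) / n \<le> max (- \<nu> (m - 1 - i) / m) 0 + 6 * sqrt (cut_distance A B)" (is ?nAB)
    and "- \<nu> (m - 1 - i) / m \<le> max (- \<mu> (n - 1 - i) / n) 0 + 6 * sqrt (cut_distance A B)" (is ?nBA)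
proof -
  let ?f = "\<lambda>k l. A $$ (k, l)" and ?g = "\<lambda>k l. B $$ (k, l)"
  obtain u where E: "orthonormal_eigenbasis n ?f u \<mu>"
    using hermitian_eigenbasis(3)[OF A] unfolding \<mu>_def by blast
  obtain w where E': "orthonormal_eigenbasis m ?g w \<nu>"
    using hermitian_eigenbasis(3)[OF B] unfolding \<nu>_def by blast
  have \<mu>: "\<mu> l \<le> \<mu> j" if "j \<le> l" "l < n" for j l
    using hermitian_eigenbasis(2)[OF A that] by (simp add: \<mu>_def)
  have \<nu>: "\<nu> l \<le> \<nu> j" if "j \<le> l" "l < m" for j l
    using hermitian_eigenbasis(2)[OF B that] by (simp add: \<nu>_def)
  note nE = orthonormal_eigenbasis_uminus[OF E] and nE' = orthonormal_eigenbasis_uminus[OF E']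
  have f: "?f b a = cnj (?f a b) \<and> cmod (?f a b) \<le> 1" if "a < n" "b < n" for a b
    using A(2)[unfolded hermitian_mat_iff[OF A(1)]] A1 that by blast
  have g: "?g b a = cnj (?g a b) \<and> cmod (?g a b) \<le> 1" if "a < m" "b < m" for a b
    using B(2)[unfolded hermitian_mat_iff[OF B(1)]] B1 that by blast
  have nf: "- ?f b a = cnj (- ?f a b) \<and> cmod (- ?f a b) \<le> 1" if "a < n" "b < n" for a b
    using f[OF that] by simp
  have ng: "- ?g b a = cnj (- ?g a b) \<and> cmod (- ?g a b) \<le> 1" if "a < m" "b < m" for a b
    using g[OF that] by simp
  have n\<mu>: "- \<mu> (n - 1 - l) \<le> - \<mu> (n - 1 - j)" if "j \<le> l" "l < n" for j l
    using \<mu>[of "n - 1 - l" "n - 1 - j"] that by simp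
  have n\<nu>: "- \<nu> (m - 1 - l) \<le> - \<nu> (m - 1 - j)" if "j \<le> l" "l < m" for j l
    using \<nu>[of "m - 1 - l" "m - 1 - j"] that by simp
  have lim: "(\<lambda>k. x + 6 * sqrt (blow_up_distance A B k)) \<longlonglongrightarrow> x + 6 * sqrt (cut_distance A B)" for x
    by (intro tendsto_intros blow_up_distance_LIMSEQ[OF A(1) B(1) pos A1 B1])
  have each: "\<mu> i / n \<le> max (\<nu> i / m) 0 + 6 * sqrt (blow_up_distance A B k) \<and>
      \<nu> i / m \<le> max (\<mu> i / n) 0 + 6 * sqrt (blow_up_distance A B k) \<and>
      - \<mu> (n - 1 - i) / n \<le> max (- \<nu> (m - 1 - i) / m) 0 + 6 * sqrt (blow_up_distance A B k) \<and>
      - \<nu> (m - 1 - i) / m \<le> max (- \<mu> (n - 1 - i) / n) 0 + 6 * sqrt (blow_up_distance A B k)"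
    if k: "k \<ge> 1" for k
  proof -
    define N where "N = n * (k * m)"
    have N: "N > 0" "N = m * (k * n)" and k0: "k > 0" using pos k by (simp_all add: N_def)
    obtain \<pi> where \<pi>: "\<pi> permutes {..<N}"
      and cut: "cut_bounded {..<N} (labelled_difference A B (\<lambda>x. x div (k * m)) (\<lambda>x. \<pi> x div (k * n)))
         (blow_up_distance A B k * (real N)\<^sup>2)"
      using blow_up_distance_attained[OF A(1) B(1) N_def N(1)] by blast
    have cut': "cut_bounded {..<N} (labelled_difference B A (\<lambda>x. \<pi> x div (k * n)) (\<lambda>x. x div (k * m)))
         (blow_up_distance A B k * (real N)\<^sup>2)"
      using cut_bounded_uminus[OF cut] by simp
    have \<alpha>: "balanced_labelling {..<N} (\<lambda>x. x div (k * m)) n (k * m)"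
      unfolding N_def by (rule balanced_labelling_div)
    have \<beta>: "balanced_labelling {..<N} (\<lambda>x. \<pi> x div (k * n)) m (k * n)"
      by (rule balanced_labelling_permute[OF _ \<pi>]) (simp only: N(2) balanced_labelling_div)
    have ncut: "cut_bounded {..<N} (\<lambda>x y. - A $$ (x div (k * m), y div (k * m))
        - (- B $$ (\<pi> x div (k * n), \<pi> y div (k * n)))) (blow_up_distance A B k * (real N)\<^sup>2)"
      using cut' by (simp only: diff_minus_eq_add uminus_add_conv_diff)
    have ncut': "cut_bounded {..<N} (\<lambda>x y. - B $$ (\<pi> x div (k * n), \<pi> y div (k * n))
        - (- A $$ (x div (k * m), y div (k * m)))) (blow_up_distance A B k * (real N)\<^sup>2)"
      using cut by (simp only: diff_minus_eq_add uminus_add_conv_diff)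
    show ?thesis
    proof (intro conjI)
      show "\<mu> i / n \<le> max (\<nu> i / m) 0 + 6 * sqrt (blow_up_distance A B k)"
        by (rule eigenvalue_comparison_cut_bounded[OF E \<mu> E' \<nu> f g N_def k0 \<alpha> \<beta> cut i])
      show "\<nu> i / m \<le> max (\<mu> i / n) 0 + 6 * sqrt (blow_up_distance A B k)"
        by (rule eigenvalue_comparison_cut_bounded[OF E' \<nu> E \<mu> g f N(2) k0 \<beta> \<alpha> cut' i(2,1)])
      show "- \<mu> (n - 1 - i) / n \<le> max (- \<nu> (m - 1 - i) / m) 0 + 6 * sqrt (blow_up_distance A B k)"
        by (rule eigenvalue_comparison_cut_bounded[OF nE n\<mu> nE' n\<nu> nf ng N_def k0 \<alpha> \<beta> ncut i])
      show "- \<nu> (m - 1 - i) / m \<le> max (- \<mu> (n - 1 - i) / n) 0 + 6 * sqrt (blow_up_distance A B k)"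
        by (rule eigenvalue_comparison_cut_bounded[OF nE' n\<nu> nE n\<mu> ng nf N(2) k0 \<beta> \<alpha> ncut' i(2,1)])
    qed
  qed
  show ?AB ?BA ?nAB ?nBA
    by (rule LIMSEQ_le_const[OF lim], use each in blast)+
qed

lemma max_entry_norm_bound:
  assumes "M \<in> carrier_mat n n" "i < n" "j < n"
  shows "cmod (M $$ (i, j)) \<le> max_entry_norm M"
proof -
  have "M $$ (i, j) \<in> elements_mat M" using assms unfolding elements_mat_def by force
  moreover have "finite (elements_mat M)" by (simp add: elements_mat_def)
  ultimately show ?thesis unfolding max_entry_norm_def by (intro Max_ge) auto
qed

text \<open>Two nonnegative numbers agree with their positive parts. If one of the numbers is negative, its
modulus is bounded separately by \<open>s\<close> or \<open>t\<close>, and the other one is negative as well or at most \<open>e\<close>.\<close>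

lemma abs_diff_le_of_positive_parts:
  fixes x y :: real
  assumes "x \<le> max y 0 + e" "y \<le> max x 0 + e" "e \<ge> 0"
  shows "x \<ge> 0 \<Longrightarrow> y \<ge> 0 \<Longrightarrow> \<bar>x - y\<bar> \<le> e"
    and "(x \<le> 0 \<Longrightarrow> - x \<le> s) \<Longrightarrow> (y \<le> 0 \<Longrightarrow> - y \<le> t) \<Longrightarrow> s \<ge> 0 \<Longrightarrow> t \<ge> 0 \<Longrightarrow> \<bar>x - y\<bar> \<le> s + t + e"
  using assms by (auto simp: max_def split: if_splits)

theorem theorem6:
  fixes n m :: nat and A B :: "complex mat"
  assumes "n \<ge> m" and "m \<ge> 1"
    and "A \<in> carrier_mat n n" and "hermitian_mat A"
    and "B \<in> carrier_mat m m" and "hermitian_mat B"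
    and "max_entry_norm A = 1" and "max_entry_norm B = 1"
  shows
    "(\<forall>i::nat. 1 \<le> i \<and> int i \<le> \<lceil>real m / 2\<rceil> \<longrightarrow>
        \<bar>ith_eigenvalue i A / real n - ith_eigenvalue i B / real m\<bar>
          \<le> 1 / sqrt (real n / 2) + 1 / sqrt (real m / 2) + 6 * sqrt (cut_distance A B) \<and>
        \<bar>ith_eigenvalue (n - i + 1) A / real n - ith_eigenvalue (m - i + 1) B / real m\<bar>
          \<le> 1 / sqrt (real n / 2) + 1 / sqrt (real m / 2) + 6 * sqrt (cut_distance A B)) \<and>
     (\<forall>i\<in>{1..m}. ith_eigenvalue i A \<ge> 0 \<and> ith_eigenvalue i B \<ge> 0 \<longrightarrow>
        \<bar>ith_eigenvalue i A / real n - ith_eigenvalue i B / real m\<bar>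
          \<le> 6 * sqrt (cut_distance A B)) \<and>
     (\<forall>i\<in>{1..m}. ith_eigenvalue (n - i + 1) A \<le> 0 \<and> ith_eigenvalue (m - i + 1) B \<le> 0 \<longrightarrow>
        \<bar>ith_eigenvalue (n - i + 1) A / real n - ith_eigenvalue (m - i + 1) B / real m\<bar>
          \<le> 6 * sqrt (cut_distance A B))"
proof -
  note A = assms(3,4) and B = assms(5,6)
  have pos: "n > 0" "m > 0" using assms(1,2) by auto
  have A1: "cmod (A $$ (i, j)) \<le> 1" if "i < n" "j < n" for i j
    using max_entry_norm_bound[OF A(1) that] assms(7) by simp
  have B1: "cmod (B $$ (i, j)) \<le> 1" if "i < m" "j < m" for i j
    using max_entry_norm_bound[OF B(1) that] assms(8) by simp
  define \<mu> where "\<mu> j = eigenvalue_list A ! j" for j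
  define \<nu> where "\<nu> j = eigenvalue_list B ! j" for j
  define e where "e = 6 * sqrt (cut_distance A B)"
  have "cut_distance A B \<ge> 0"
    using blow_up_distance_nonneg[OF A(1) B(1) pos]
    by (intro LIMSEQ_le_const[OF blow_up_distance_LIMSEQ[OF A(1) B(1) pos A1 B1]] exI[of _ 1]) auto
  then have e: "e \<ge> 0" by (simp add: e_def)
  have compare: "\<mu> i / n \<le> max (\<nu> i / m) 0 + e" "\<nu> i / m \<le> max (\<mu> i / n) 0 + e"
    "- \<mu> (n - 1 - i) / n \<le> max (- \<nu> (m - 1 - i) / m) 0 + e"
    "- \<nu> (m - 1 - i) / m \<le> max (- \<mu> (n - 1 - i) / n) 0 + e"
    if "i < n" "i < m" for i
    unfolding \<mu>_def \<nu>_def e_def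
    using eigenvalue_comparison_cut_distance[OF pos A B _ _ that] A1 B1 by blast+
  have ith: "ith_eigenvalue i A = \<mu> (i - 1)" "ith_eigenvalue i B = \<nu> (i - 1)"
    "ith_eigenvalue (n - i + 1) A = \<mu> (n - 1 - (i - 1))" "ith_eigenvalue (m - i + 1) B = \<nu> (m - 1 - (i - 1))"
    if "1 \<le> i" for i
    using that by (simp_all add: ith_eigenvalue_def \<mu>_def \<nu>_def)
  \<comment> \<open>Eigenvalues of the wrong sign, at both ends of the spectrum; the second part is the first for
    the negated matrix.\<close>
  have negative: "(eigenvalue_list M ! i \<le> 0 \<longrightarrow> - eigenvalue_list M ! i / d \<le> 1 / sqrt (real d / 2)) \<and>
      (eigenvalue_list M ! (d - 1 - i) \<ge> 0 \<longrightarrow> eigenvalue_list M ! (d - 1 - i) / d \<le> 1 / sqrt (real d / 2))"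
    if M: "M \<in> carrier_mat d d" "hermitian_mat M" and M1: "\<forall>i<d. \<forall>j<d. cmod (M $$ (i, j)) \<le> 1"
      and i: "2 * i < d + 1" "i < d" for M d i
  proof -
    obtain u where E: "orthonormal_eigenbasis d (\<lambda>k l. M $$ (k, l)) u (\<lambda>j. eigenvalue_list M ! j)"
      using hermitian_eigenbasis(3)[OF M] by blast
    note sorted = hermitian_eigenbasis(2)[OF M]
    have "- eigenvalue_list M ! i / d \<le> 1 / sqrt (real d / 2)" if "eigenvalue_list M ! i \<le> 0"
      by (rule negative_middle_eigenvalue_bound[OF E _ _ i that]) (use sorted M1 in auto)
    moreover have "- (- eigenvalue_list M ! (d - 1 - i)) / d \<le> 1 / sqrt (real d / 2)"
      if "- eigenvalue_list M ! (d - 1 - i) \<le> 0"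
      by (rule negative_middle_eigenvalue_bound[OF orthonormal_eigenbasis_uminus[OF E] _ _ i that])
        (use sorted M1 in auto)
    ultimately show ?thesis by simp
  qed
  show ?thesis
    unfolding e_def[symmetric]
  proof (intro conjI allI ballI impI)
    fix i :: nat assume "1 \<le> i \<and> int i \<le> \<lceil>real m / 2\<rceil>"
    then have i1: "1 \<le> i" and i: "2 * (i - 1) < m + 1" "2 * (i - 1) < n + 1" "i - 1 < m" "i - 1 < n"
      using assms(1,2) by linarith+
    have "\<forall>i<n. \<forall>j<n. cmod (A $$ (i, j)) \<le> 1" "\<forall>i<m. \<forall>j<m. cmod (B $$ (i, j)) \<le> 1"
      using A1 B1 by blast+
    note negA = negative[OF A this(1) i(2,4), folded \<mu>_def]
      and negB = negative[OF B this(2) i(1,3), folded \<nu>_def]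
    show "\<bar>ith_eigenvalue i A / real n - ith_eigenvalue i B / real m\<bar>
        \<le> 1 / sqrt (real n / 2) + 1 / sqrt (real m / 2) + e"
      unfolding ith[OF i1]
      by (rule abs_diff_le_of_positive_parts(2)[OF compare(1,2)[OF i(4,3)] e])
        (use negA negB pos in \<open>auto simp: divide_le_0_iff\<close>)
    have "\<bar>(- \<mu> (n - 1 - (i - 1)) / n) - (- \<nu> (m - 1 - (i - 1)) / m)\<bar>
        \<le> 1 / sqrt (real n / 2) + 1 / sqrt (real m / 2) + e"
      by (rule abs_diff_le_of_positive_parts(2)[OF compare(3,4)[OF i(4,3)] e])
        (use negA negB pos in \<open>auto simp: divide_le_0_iff zero_le_divide_iff\<close>)
    then show "\<bar>ith_eigenvalue (n - i + 1) A / real n - ith_eigenvalue (m - i + 1) B / real m\<bar>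
        \<le> 1 / sqrt (real n / 2) + 1 / sqrt (real m / 2) + e"
      unfolding ith[OF i1] by (simp add: abs_minus_commute)
  next
    fix i assume i: "i \<in> {1..m}" and sgn: "ith_eigenvalue i A \<ge> 0 \<and> ith_eigenvalue i B \<ge> 0"
    then have i1: "1 \<le> i" "i - 1 < n" "i - 1 < m" using assms(1) by auto
    show "\<bar>ith_eigenvalue i A / real n - ith_eigenvalue i B / real m\<bar> \<le> e"
      unfolding ith[OF i1(1)]
      by (rule abs_diff_le_of_positive_parts(1)[OF compare(1,2)[OF i1(2,3)] e])
        (use sgn in \<open>auto simp: ith[OF i1(1)]\<close>)
  next
    fix i assume i: "i \<in> {1..m}" and sgn: "ith_eigenvalue (n - i + 1) A \<le> 0 \<and> ith_eigenvalue (m - i + 1) B \<le> 0"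
    then have i1: "1 \<le> i" "i - 1 < n" "i - 1 < m" using assms(1) by auto
    have "\<bar>(- \<mu> (n - 1 - (i - 1)) / n) - (- \<nu> (m - 1 - (i - 1)) / m)\<bar> \<le> e"
      by (rule abs_diff_le_of_positive_parts(1)[OF compare(3,4)[OF i1(2,3)] e])
        (use sgn[unfolded ith[OF i1(1)]] in \<open>auto simp: divide_le_0_iff\<close>)
    then show "\<bar>ith_eigenvalue (n - i + 1) A / real n - ith_eigenvalue (m - i + 1) B / real m\<bar> \<le> e"
      unfolding ith[OF i1(1)] by (simp add: abs_minus_commute)
  qed
qed

end
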